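(* Let $A\in\mathbb{C}^{(n+1)\times(n+1)}$ be a nonzero matrix and let $1\le k\le n$ be an integer. It holds that $$\|A^k\|=2\max_{\zeta\in W(A)}|\zeta^k|$$ if and only if $A$ is unitarily similar to a matrix of the form $$r(A)\,(C_k\oplus B),$$ where $C_k$ is the Crabb-Choi-Crouzeix matrix and $B$ is a square matrix of size $n-k$ satisfying $r(B)\le 1$ and $\|B^k\|\le 2$.
   Context: $\|\cdot\|$ is the matrix 2-norm (operator norm for the Euclidean norm) and $\langle z,w\rangle=w^*z$. For a square matrix $A$, $W(A)=\{\langle Az,z\rangle:\ \|z\|=1\}$ is the field of values and $r(A)=\max_{\|z\|=1}|\langle Az,z\rangle|=\max_{\zeta\in W(A)}|\zeta|$ is the numerical radius. The Crabb-Choi-Crouzeix matrix $C_k\in\mathbb{R}^{(k+1)\times(k+1)}$ is defined by $C_1=\begin{bmatrix}0&2\\0&0\end{bmatrix}$ and, for $k>1$, $C_k$ is the matrix whose only nonzero entries are on the first superdiagonal, these being, in order, $\sqrt2,1,\dots,1,\sqrt2$ (that is, the $(1,2)$ and $(k,k+1)$ entries equal $\sqrt2$ and the $(i,i+1)$ entries equal $1$ for $2\le i\le k-1$). $\oplus$ denotes the block-diagonal matrix with the given blocks; if $k=n$, the block $B$ is absent and the conditions on it are vacuous. Matrices $M,N$ are unitarily similar if $N=Q^*MQ$ for some unitary $Q$. *)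

theory Defs
  imports "Jordan_Normal_Form.Schur_Decomposition" "HOL-Analysis.L2_Norm"
begin

definition vec_norm2 :: "complex vec \<Rightarrow> real" where
  "vec_norm2 z = L2_set (\<lambda>i. cmod (z $ i)) {0..<dim_vec z}"

(* The inner product <z,w> = w^* z is the library's  z \<bullet>c w.

   The maxima over the unit sphere are attained (compactness) for matrices of size at
   least one and are written as suprema. For the 0 x 0 matrix the sphere is empty, and
   these real suprema carry no information; uses must exclude that case. *)

definition unit_vecs :: "nat \<Rightarrow> complex vec set" where
  "unit_vecs m = {z \<in> carrier_vec m. vec_norm2 z = 1}"

definition mat_norm2 :: "complex mat \<Rightarrow> real" where
  "mat_norm2 A = (SUP z\<in>unit_vecs (dim_col A). vec_norm2 (A *\<^sub>v z))"

definition field_of_values :: "complex mat \<Rightarrow> complex set" where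
  "field_of_values A = (\<lambda>z. (A *\<^sub>v z) \<bullet>c z) ` unit_vecs (dim_row A)"

definition numerical_radius :: "complex mat \<Rightarrow> real" where
  "numerical_radius A = (SUP \<zeta>\<in>field_of_values A. cmod \<zeta>)"

(* Indices start at 0, so the superdiagonal entries sit at (i, i + 1) with i < k,
   and the first and last of them are those with i = 0 and i + 1 = k. *)
definition ccc_mat :: "nat \<Rightarrow> complex mat" where
  "ccc_mat k = mat (k + 1) (k + 1) (\<lambda>(i, j).
     if j = i + 1
     then (if k = 1 then 2 else if i = 0 \<or> i + 1 = k then complex_of_real (sqrt 2) else 1)
     else 0)"

definition unitary_mat :: "nat \<Rightarrow> complex mat \<Rightarrow> bool" where
  "unitary_mat m Q \<longleftrightarrow>
     Q \<in> carrier_mat m m \<and> mat_adjoint Q * Q = 1\<^sub>m m \<and> Q * mat_adjoint Q = 1\<^sub>m m"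

definition unitarily_similar :: "complex mat \<Rightarrow> complex mat \<Rightarrow> bool" where
  "unitarily_similar M N \<longleftrightarrow>
     (\<exists>m Q. M \<in> carrier_mat m m \<and> N \<in> carrier_mat m m \<and> unitary_mat m Q \<and>
        N = mat_adjoint Q * M * Q)"

end

theory Submission
  imports Defs "HOL-Analysis.Function_Topology"
begin

text \<open>
  Put \<open>T = A / r(A)\<close>. Since \<open>max |\<zeta>\<^sup>k| = r(A)\<^sup>k\<close> over the field of values, the claim concerns the
  equality case of Crabb's inequality \<open>\<parallel>T\<^sup>k\<parallel> \<le> 2\<close> for a matrix with \<open>r(T) \<le> 1\<close>.

  The inequality comes from one quadratic form on finite sequences of vectors,
  \<open>S(v) = \<Sum> \<parallel>v\<^sub>i\<parallel>\<^sup>2 - Re \<Sum> \<langle>T v\<^sub>i, v\<^sub>i\<^sub>+\<^sub>1\<rangle>\<close>. If \<open>r(T) \<le> 1\<close> then \<open>Re (\<omega> \<langle>T y, y\<rangle>) \<le> \<parallel>y\<parallel>\<^sup>2\<close>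
  for every unimodular \<open>\<omega>\<close>. Taking \<open>y = \<Sum> \<omega>\<^sup>i v\<^sub>i\<close> and averaging over sufficiently many roots of
  unity \<open>\<omega>\<close> kills all products except those in \<open>S\<close>, so \<open>S \<ge> 0\<close> (\<open>shift_form_nonneg\<close>).
  On the sequence \<open>x, T x, \<dots>, T\<^sup>k\<^sup>-\<^sup>1 x, T\<^sup>k x / 2\<close> the form telescopes to
  \<open>\<parallel>x\<parallel>\<^sup>2 - \<parallel>T\<^sup>k x\<parallel>\<^sup>2 / 4\<close>, which is Crabb's inequality (\<open>crabb_inequality\<close>).

  If equality holds at a unit vector \<open>x\<close>, the sequence minimizes the nonnegative form \<open>S\<close>, hence it
  is a stationary point: \<open>2 v\<^sub>i = T v\<^sub>i\<^sub>-\<^sub>1 + T\<^sup>* v\<^sub>i\<^sub>+\<^sub>1\<close>, also when the sequence is continued by zeros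
  on both sides. These equations say that \<open>T\<close> and \<open>T\<^sup>*\<close> are weighted shifts along the sequence, in
  opposite directions, which annihilate the entries at the two ends. Such a double ladder is automatically orthogonal, its span reduces
  \<open>T\<close>, and after normalization and reversal of the order the weights are those of the
  Crabb-Choi-Crouzeix matrix (\<open>crabb_extremal_structure\<close>). Completing the ladder to an orthonormal
  basis gives the block form; the other block is a compression of \<open>T\<close>, so it again has numerical
  radius at most one and Crabb's inequality bounds its \<open>k\<close>-th power.

  Conversely, in \<open>r(A) (C\<^sub>k \<oplus> B)\<close> the weights of \<open>C\<^sub>k\<close> multiply to 2, so \<open>A\<^sup>k\<close> stretches one unit
  vector by \<open>2 r(A)\<^sup>k\<close>, and Crabb's inequality shows that no unit vector is stretched more.
\<close>

section \<open>Inner products and norms of complex vectors\<close>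

lemma cscalar_prod_sum:
  assumes "w \<in> carrier_vec m"
  shows "v \<bullet>c w = (\<Sum>i = 0..<m. v $ i * cnj (w $ i))"
  using assms by (simp add: scalar_prod_def)

lemma mult_mat_vec_index_sum:
  assumes "A \<in> carrier_mat l m" "v \<in> carrier_vec m" "i < l"
  shows "(A *\<^sub>v v) $ i = (\<Sum>j = 0..<m. A $$ (i, j) * v $ j)"
  using assms by (simp add: scalar_prod_def)

lemma mult_mat_vec_in_carrier [intro]:
  "A \<in> carrier_mat m m \<Longrightarrow> v \<in> carrier_vec m \<Longrightarrow> A *\<^sub>v v \<in> carrier_vec m"
  by simp

lemma cscalar_prod_add_left:
  fixes u :: "complex vec"
  assumes "u \<in> carrier_vec m" "v \<in> carrier_vec m" "w \<in> carrier_vec m"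
  shows "(u + v) \<bullet>c w = u \<bullet>c w + v \<bullet>c w"
  using assms by (simp add: cscalar_prod_sum[of w m] sum.distrib algebra_simps)

lemma cscalar_prod_add_right:
  fixes u :: "complex vec"
  assumes "u \<in> carrier_vec m" "v \<in> carrier_vec m" "w \<in> carrier_vec m"
  shows "w \<bullet>c (u + v) = w \<bullet>c u + w \<bullet>c v"
  using assms by (simp add: cscalar_prod_sum[where m = m] sum.distrib algebra_simps)

lemma cscalar_prod_smult_left:
  fixes u :: "complex vec"
  assumes "u \<in> carrier_vec m" "w \<in> carrier_vec m"
  shows "(a \<cdot>\<^sub>v u) \<bullet>c w = a * (u \<bullet>c w)"
  using assms by (simp add: cscalar_prod_sum[of w m] sum_distrib_left mult.assoc)

lemma cscalar_prod_smult_right: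
  fixes u :: "complex vec"
  assumes "u \<in> carrier_vec m" "w \<in> carrier_vec m"
  shows "w \<bullet>c (a \<cdot>\<^sub>v u) = cnj a * (w \<bullet>c u)"
  using assms by (simp add: cscalar_prod_sum[where m = m] sum_distrib_left mult_ac)

lemma cscalar_prod_zero_left:
  fixes w :: "complex vec"
  assumes "w \<in> carrier_vec m"
  shows "0\<^sub>v m \<bullet>c w = 0"
  using assms by (simp add: cscalar_prod_sum[of w m])

lemma cscalar_prod_zero_right:
  fixes w :: "complex vec"
  assumes "w \<in> carrier_vec m"
  shows "w \<bullet>c 0\<^sub>v m = 0"
  using assms by (simp add: cscalar_prod_sum[where m = m])

lemmas cscalar_prod_linear =
  cscalar_prod_add_left cscalar_prod_add_right
  cscalar_prod_smult_left cscalar_prod_smult_right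
  cscalar_prod_zero_left cscalar_prod_zero_right

lemma cscalar_prod_commute:
  fixes u :: "complex vec"
  assumes "u \<in> carrier_vec m" "w \<in> carrier_vec m"
  shows "w \<bullet>c u = cnj (u \<bullet>c w)"
  using assms by (simp add: cscalar_prod_sum[where m = m] mult.commute)

lemma index_mat_adjoint:
  fixes A :: "complex mat"
  assumes "i < dim_col A" "j < dim_row A"
  shows "mat_adjoint A $$ (i, j) = cnj (A $$ (j, i))"
  using assms by (simp add: mat_adjoint_def mat_of_rows_def)

lemma dim_mat_adjoint [simp]:
  fixes A :: "complex mat"
  shows "dim_row (mat_adjoint A) = dim_col A" "dim_col (mat_adjoint A) = dim_row A"
  by (simp_all add: mat_adjoint_def)

lemma mat_adjoint_carrier [simp]:
  fixes A :: "complex mat"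
  shows "A \<in> carrier_mat l m \<Longrightarrow> mat_adjoint A \<in> carrier_mat m l"
  unfolding carrier_mat_def by simp

lemma cscalar_prod_adjoint:
  fixes A :: "complex mat"
  assumes A: "A \<in> carrier_mat l m" and v: "v \<in> carrier_vec m" and w: "w \<in> carrier_vec l"
  shows "(A *\<^sub>v v) \<bullet>c w = v \<bullet>c (mat_adjoint A *\<^sub>v w)"
proof -
  have A': "mat_adjoint A \<in> carrier_mat m l" using A by simp
  have dA: "dim_row A = l" "dim_col A = m" using A by auto
  have Aw: "mat_adjoint A *\<^sub>v w \<in> carrier_vec m" using A' w by simp
  have "(A *\<^sub>v v) \<bullet>c w = (\<Sum>i = 0..<l. \<Sum>j = 0..<m. A $$ (i, j) * v $ j * cnj (w $ i))"
    by (simp add: cscalar_prod_sum[OF w] mult_mat_vec_index_sum[OF A v] sum_distrib_right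
             del: index_mult_mat_vec)
  also have "\<dots> = (\<Sum>j = 0..<m. \<Sum>i = 0..<l. A $$ (i, j) * v $ j * cnj (w $ i))"
    by (rule sum.swap)
  also have "\<dots> = v \<bullet>c (mat_adjoint A *\<^sub>v w)"
    by (simp add: cscalar_prod_sum[OF Aw] mult_mat_vec_index_sum[OF A' w]
        index_mat_adjoint dA sum_distrib_left mult_ac del: index_mult_mat_vec)
  finally show ?thesis .
qed

lemma mult_mat_zero_vec [simp]:
  fixes A :: "complex mat"
  assumes "A \<in> carrier_mat l m"
  shows "A *\<^sub>v 0\<^sub>v m = 0\<^sub>v l"
  using assms by (intro eq_vecI) (auto simp: scalar_prod_def)

lemma smult_zero_vec_complex [simp]: "(a :: complex) \<cdot>\<^sub>v 0\<^sub>v m = 0\<^sub>v m"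
  by (intro eq_vecI) auto

lemma cscalar_prod_self:
  assumes "v \<in> carrier_vec m"
  shows "v \<bullet>c v = complex_of_real ((vec_norm2 v)\<^sup>2)"
proof -
  have "0 \<le> (\<Sum>i = 0..<m. (cmod (v $ i))\<^sup>2)" by (simp add: sum_nonneg)
  then show ?thesis
    using assms
    by (simp add: cscalar_prod_sum vec_norm2_def L2_set_def complex_norm_square
             del: of_real_power)
qed

lemma vec_norm2_nonneg [simp]: "0 \<le> vec_norm2 v"
  by (simp add: vec_norm2_def L2_set_nonneg)

lemma vec_norm2_eq_0_iff:
  assumes "v \<in> carrier_vec m"
  shows "vec_norm2 v = 0 \<longleftrightarrow> v = 0\<^sub>v m"
  using assms cscalar_prod_self[OF assms] conjugate_square_eq_0_vec[OF assms] by auto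

lemma vec_norm2_smult:
  "vec_norm2 (a \<cdot>\<^sub>v v) = cmod a * vec_norm2 v"
proof -
  have "(\<Sum>i = 0..<dim_vec v. (cmod ((a \<cdot>\<^sub>v v) $ i))\<^sup>2)
      = (cmod a)\<^sup>2 * (\<Sum>i = 0..<dim_vec v. (cmod (v $ i))\<^sup>2)"
    by (simp add: norm_mult power_mult_distrib sum_distrib_left)
  then show ?thesis by (simp add: vec_norm2_def L2_set_def real_sqrt_mult)
qed

lemma normalize_in_unit_vecs:
  assumes "v \<in> carrier_vec m" "v \<noteq> 0\<^sub>v m"
  shows "complex_of_real (1 / vec_norm2 v) \<cdot>\<^sub>v v \<in> unit_vecs m"
  using assms vec_norm2_eq_0_iff[OF assms(1)]
  by (simp add: unit_vecs_def vec_norm2_smult norm_divide)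

lemma unit_vec_in_unit_vecs:
  assumes "i < m"
  shows "unit_vec m i \<in> unit_vecs m"
proof -
  have "complex_of_real ((vec_norm2 (unit_vec m i))\<^sup>2) = 1"
    using assms cscalar_prod_self[of "unit_vec m i" m]
    by (simp add: cscalar_prod_sum[where m = m] if_distrib sum.delta cong: if_cong)
  then have "(vec_norm2 (unit_vec m i))\<^sup>2 = 1"
    using of_real_eq_1_iff by blast
  then have "vec_norm2 (unit_vec m i) = 1"
    using vec_norm2_nonneg by (simp add: power2_eq_1_iff) (smt (verit) vec_norm2_nonneg)
  then show ?thesis by (simp add: unit_vecs_def)
qed

section \<open>Attained maxima on the unit sphere\<close>

text \<open>
  The sphere is compact: it is the intersection of a closed set with a product of compact squares
  of the complex plane, where coordinate functions are taken to vanish from index \<open>m\<close> on.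
\<close>
lemma unit_vecs_attains_max:
  fixes g :: "complex vec \<Rightarrow> real"
  assumes m: "0 < m"
    and cont: "continuous_on UNIV (\<lambda>f :: nat \<Rightarrow> complex. g (vec m f))"
  shows "\<exists>z \<in> unit_vecs m. \<forall>w \<in> unit_vecs m. g w \<le> g z"
proof -
  define D :: "complex set" where "D = (\<lambda>(a, b). Complex a b) ` ({-1..1} \<times> {-1..1})"
  have "compact D"
    unfolding D_def Complex_eq case_prod_unfold
    by (intro compact_continuous_image compact_Times compact_Icc continuous_intros)
  define P :: "(nat \<Rightarrow> complex) set"
    where "P = PiE UNIV (\<lambda>i. if i < m then D else {0})"
  define S :: "(nat \<Rightarrow> complex) set" where "S = {f. (\<Sum>i = 0..<m. (cmod (f i))\<^sup>2) = 1}"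
  have "compactin (product_topology (\<lambda>i. euclidean) UNIV) P"
    unfolding P_def compactin_PiE using \<open>compact D\<close> by auto
  then have "compact P" by (simp add: euclidean_product_topology)
  moreover have "closed S"
    unfolding S_def by (intro closed_Collect_eq continuous_intros continuous_on_product_coordinates)
  ultimately have comp: "compact (P \<inter> S)" by (rule compact_Int_closed)
  have unit_iff: "vec m f \<in> unit_vecs m \<longleftrightarrow> f \<in> S" for f
    by (simp add: unit_vecs_def vec_norm2_def L2_set_def S_def)
  have mem: "(\<lambda>i. if i < m then w $ i else 0) \<in> P \<inter> S" if w: "w \<in> unit_vecs m" for w
  proof -
    have "vec m (\<lambda>i. if i < m then w $ i else 0) = w"
      using w by (auto simp: unit_vecs_def)
    then have S: "(\<lambda>i. if i < m then w $ i else 0) \<in> S" using w unit_iff by metis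
    then have s: "(\<Sum>i = 0..<m. (cmod (w $ i))\<^sup>2) = 1" by (simp add: S_def)
    have "w $ i \<in> D" if "i < m" for i
    proof -
      have "(cmod (w $ i))\<^sup>2 \<le> (\<Sum>i = 0..<m. (cmod (w $ i))\<^sup>2)"
        by (rule member_le_sum) (use that in auto)
      then have "cmod (w $ i) \<le> 1" using s by (simp add: abs_square_le_1)
      then have "\<bar>Re (w $ i)\<bar> \<le> 1" "\<bar>Im (w $ i)\<bar> \<le> 1"
        using abs_Re_le_cmod abs_Im_le_cmod by (meson order_trans)+
      then show ?thesis
        unfolding D_def by (intro image_eqI[of _ _ "(Re (w $ i), Im (w $ i))"]) auto
    qed
    with S show ?thesis by (auto simp: P_def)
  qed
  have "P \<inter> S \<noteq> {}" using mem[OF unit_vec_in_unit_vecs[OF m]] by blast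
  then obtain f where f: "f \<in> P \<inter> S" "\<forall>h \<in> P \<inter> S. g (vec m h) \<le> g (vec m f)"
    using continuous_attains_sup[OF comp _ continuous_on_subset[OF cont]] by blast
  show ?thesis
  proof (intro bexI ballI)
    show "vec m f \<in> unit_vecs m" using f unit_iff by auto
    fix w assume w: "w \<in> unit_vecs m"
    have "vec m (\<lambda>i. if i < m then w $ i else 0) = w"
      using w by (auto simp: unit_vecs_def)
    then show "g w \<le> g (vec m f)" using f(2) mem[OF w] by metis
  qed
qed

text \<open>
  The maximizer of the norm of a power is the vector from which the extremal ladder grows;
  boundedness is what makes the real suprema in the definitions upper bounds.
\<close>
lemma mat_norm2_attained:
  assumes A: "A \<in> carrier_mat m m" and m: "0 < m"
  shows "\<exists>z \<in> unit_vecs m. mat_norm2 A = vec_norm2 (A *\<^sub>v z)"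
    and "z \<in> unit_vecs m \<Longrightarrow> vec_norm2 (A *\<^sub>v z) \<le> mat_norm2 A"
proof -
  have "vec_norm2 (A *\<^sub>v vec m f)
      = sqrt (\<Sum>i = 0..<m. (cmod (\<Sum>j = 0..<m. A $$ (i, j) * f j))\<^sup>2)" for f
    using A by (simp add: vec_norm2_def L2_set_def scalar_prod_def)
  then have "continuous_on UNIV (\<lambda>f. vec_norm2 (A *\<^sub>v vec m f))"
    by (simp only:) (intro continuous_intros continuous_on_product_coordinates)
  then obtain z where z: "z \<in> unit_vecs m"
      "\<forall>w \<in> unit_vecs m. vec_norm2 (A *\<^sub>v w) \<le> vec_norm2 (A *\<^sub>v z)"
    using unit_vecs_attains_max[OF m, of "\<lambda>z. vec_norm2 (A *\<^sub>v z)"] by auto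
  have eq: "mat_norm2 A = vec_norm2 (A *\<^sub>v z)"
    unfolding mat_norm2_def using A z by (intro cSup_eq_maximum) auto
  show "\<exists>z \<in> unit_vecs m. mat_norm2 A = vec_norm2 (A *\<^sub>v z)" using z eq by blast
  show "z \<in> unit_vecs m \<Longrightarrow> vec_norm2 (A *\<^sub>v z) \<le> mat_norm2 A" for z
    using z eq by simp
qed

lemma numerical_radius_attained:
  assumes A: "A \<in> carrier_mat m m" and m: "0 < m"
  shows "\<exists>\<zeta> \<in> field_of_values A. numerical_radius A = cmod \<zeta>"
    and "\<zeta> \<in> field_of_values A \<Longrightarrow> cmod \<zeta> \<le> numerical_radius A"
proof -
  have "cmod ((A *\<^sub>v vec m f) \<bullet>c vec m f)
      = cmod (\<Sum>i = 0..<m. (\<Sum>j = 0..<m. A $$ (i, j) * f j) * cnj (f i))" for f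
    using A by (simp add: scalar_prod_def)
  then have "continuous_on UNIV (\<lambda>f. cmod ((A *\<^sub>v vec m f) \<bullet>c vec m f))"
    by (simp only:) (intro continuous_intros continuous_on_product_coordinates)
  then obtain z where z: "z \<in> unit_vecs m"
      "\<forall>w \<in> unit_vecs m. cmod ((A *\<^sub>v w) \<bullet>c w) \<le> cmod ((A *\<^sub>v z) \<bullet>c z)"
    using unit_vecs_attains_max[OF m, of "\<lambda>z. cmod ((A *\<^sub>v z) \<bullet>c z)"] by auto
  have eq: "numerical_radius A = cmod ((A *\<^sub>v z) \<bullet>c z)"
    unfolding numerical_radius_def field_of_values_def image_image
    using A z by (intro cSup_eq_maximum) auto
  show "\<exists>\<zeta> \<in> field_of_values A. numerical_radius A = cmod \<zeta>"
    using A z eq by (auto simp: field_of_values_def)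
  show "\<zeta> \<in> field_of_values A \<Longrightarrow> cmod \<zeta> \<le> numerical_radius A" for \<zeta>
    using A z eq by (auto simp: field_of_values_def)
qed

lemma Sup_cmod_power_field_of_values:
  assumes "A \<in> carrier_mat m m" "0 < m"
  shows "(SUP \<zeta> \<in> field_of_values A. cmod (\<zeta> ^ k)) = numerical_radius A ^ k"
proof -
  obtain \<zeta> where "\<zeta> \<in> field_of_values A" "numerical_radius A = cmod \<zeta>"
    using numerical_radius_attained(1)[OF assms] by blast
  then show ?thesis
    using numerical_radius_attained(2)[OF assms]
    by (intro cSup_eq_maximum) (auto simp: norm_power intro!: power_mono)
qed

lemma numerical_radius_bound:
  assumes A: "A \<in> carrier_mat m m" and v: "v \<in> carrier_vec m"
  shows "cmod ((A *\<^sub>v v) \<bullet>c v) \<le> numerical_radius A * (vec_norm2 v)\<^sup>2"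
proof (cases "v = 0\<^sub>v m")
  case True
  then show ?thesis
    using A v vec_norm2_eq_0_iff[OF v] by (simp add: cscalar_prod_zero_right)
next
  case False
  then have m: "0 < m" using v by (cases m) auto
  define a where "a = complex_of_real (1 / vec_norm2 v)"
  have nz: "vec_norm2 v \<noteq> 0" using False vec_norm2_eq_0_iff[OF v] by simp
  have "(A *\<^sub>v (a \<cdot>\<^sub>v v)) \<bullet>c (a \<cdot>\<^sub>v v) \<in> field_of_values A"
    unfolding field_of_values_def a_def
    using normalize_in_unit_vecs[OF v False] A by blast
  then have "cmod ((A *\<^sub>v (a \<cdot>\<^sub>v v)) \<bullet>c (a \<cdot>\<^sub>v v)) \<le> numerical_radius A"
    by (rule numerical_radius_attained(2)[OF A m])
  also have "A *\<^sub>v (a \<cdot>\<^sub>v v) = a \<cdot>\<^sub>v (A *\<^sub>v v)"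
    using mult_mat_vec[OF A v] .
  also have "(a \<cdot>\<^sub>v (A *\<^sub>v v)) \<bullet>c (a \<cdot>\<^sub>v v) = a * cnj a * ((A *\<^sub>v v) \<bullet>c v)"
    using A v by (simp add: cscalar_prod_smult_left[where m = m]
        cscalar_prod_smult_right[where m = m])
  also have "cmod \<dots> = cmod ((A *\<^sub>v v) \<bullet>c v) / (vec_norm2 v)\<^sup>2"
    by (simp add: a_def norm_mult norm_divide power2_eq_square)
  finally show ?thesis using nz by (simp add: divide_le_eq)
qed

section \<open>A positive quadratic form on sequences of vectors\<close>

text \<open>
  The condition that the numerical radius is at most one, in a homogeneous form that is also
  meaningful in dimension zero.
\<close>
definition numerical_contraction :: "nat \<Rightarrow> complex mat \<Rightarrow> bool" where
  "numerical_contraction m T \<longleftrightarrow> T \<in> carrier_mat m m \<and>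
     (\<forall>v \<in> carrier_vec m. cmod ((T *\<^sub>v v) \<bullet>c v) \<le> (vec_norm2 v)\<^sup>2)"

definition lin_comb :: "nat \<Rightarrow> nat \<Rightarrow> (nat \<Rightarrow> complex) \<Rightarrow> (nat \<Rightarrow> complex vec) \<Rightarrow> complex vec" where
  "lin_comb m p c v = vec m (\<lambda>a. \<Sum>i\<le>p. c i * v i $ a)"

lemma lin_comb_carrier [simp]: "lin_comb m p c v \<in> carrier_vec m"
  by (simp add: lin_comb_def)

lemma cscalar_prod_lin_comb:
  assumes "\<And>i. i \<le> p \<Longrightarrow> w i \<in> carrier_vec m"
  shows "lin_comb m p c v \<bullet>c lin_comb m p d w
    = (\<Sum>i\<le>p. \<Sum>l\<le>p. c i * cnj (d l) * (v i \<bullet>c w l))"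
proof -
  have "lin_comb m p c v \<bullet>c lin_comb m p d w
      = (\<Sum>a = 0..<m. \<Sum>i\<le>p. \<Sum>l\<le>p. c i * cnj (d l) * (v i $ a * cnj (w l $ a)))"
    by (simp add: cscalar_prod_sum[where m = m] lin_comb_def sum_product mult_ac)
  also have "\<dots> = (\<Sum>i\<le>p. \<Sum>a = 0..<m. \<Sum>l\<le>p. c i * cnj (d l) * (v i $ a * cnj (w l $ a)))"
    by (rule sum.swap)
  also have "\<dots> = (\<Sum>i\<le>p. \<Sum>l\<le>p. \<Sum>a = 0..<m. c i * cnj (d l) * (v i $ a * cnj (w l $ a)))"
    by (intro sum.cong refl sum.swap)
  also have "\<dots> = (\<Sum>i\<le>p. \<Sum>l\<le>p. c i * cnj (d l) * (v i \<bullet>c w l))"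
    using assms by (intro sum.cong refl) (simp add: cscalar_prod_sum[where m = m] sum_distrib_left)
  finally show ?thesis .
qed

lemma mult_mat_lin_comb:
  assumes T: "T \<in> carrier_mat m m" and v: "\<And>i. i \<le> p \<Longrightarrow> v i \<in> carrier_vec m"
  shows "T *\<^sub>v lin_comb m p c v = lin_comb m p c (\<lambda>i. T *\<^sub>v v i)"
proof
  show "dim_vec (T *\<^sub>v lin_comb m p c v) = dim_vec (lin_comb m p c (\<lambda>i. T *\<^sub>v v i))"
    using T by (simp add: lin_comb_def)
  fix a assume "a < dim_vec (lin_comb m p c (\<lambda>i. T *\<^sub>v v i))"
  then have a: "a < m" by (simp add: lin_comb_def)
  have "(T *\<^sub>v lin_comb m p c v) $ a = (\<Sum>b = 0..<m. \<Sum>i\<le>p. T $$ (a, b) * (c i * v i $ b))"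
    by (subst mult_mat_vec_index_sum[OF T _ a]) (simp_all add: lin_comb_def sum_distrib_left)
  also have "\<dots> = (\<Sum>i\<le>p. \<Sum>b = 0..<m. T $$ (a, b) * (c i * v i $ b))"
    by (rule sum.swap)
  also have "\<dots> = (\<Sum>i\<le>p. c i * (T *\<^sub>v v i) $ a)"
    using v by (intro sum.cong refl)
      (simp add: mult_mat_vec_index_sum[OF T _ a] sum_distrib_left mult_ac del: index_mult_mat_vec)
  finally show "(T *\<^sub>v lin_comb m p c v) $ a = lin_comb m p c (\<lambda>i. T *\<^sub>v v i) $ a"
    using a by (simp add: lin_comb_def)
qed

text \<open>
  Characters of the cyclic group of order \<open>N\<close> are orthogonal; exponents that differ by less than
  \<open>N\<close> give distinct characters.
\<close>
lemma sum_roots_of_unity: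
  fixes a b N :: nat
  defines "\<omega> \<equiv> cis (2 * pi / real N)"
  assumes "a < b + N" "b < a + N"
  shows "(\<Sum>j<N. (\<omega> ^ j) ^ a * cnj ((\<omega> ^ j) ^ b)) = (if a = b then of_nat N else 0)"
proof -
  define d where "d = int a - int b"
  define q where "q = cis (2 * pi * of_int d / real N)"
  have N: "0 < N" using assms by auto
  have "(\<omega> ^ j) ^ a * cnj ((\<omega> ^ j) ^ b) = q ^ j" for j
    by (simp add: \<omega>_def q_def d_def DeMoivre cis_cnj cis_mult algebra_simps diff_divide_distrib)
  then have sum: "(\<Sum>j<N. (\<omega> ^ j) ^ a * cnj ((\<omega> ^ j) ^ b)) = (\<Sum>j<N. q ^ j)" by simp
  show ?thesis
  proof (cases "a = b")
    case True
    then have "q = 1" by (simp add: q_def d_def)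
    then show ?thesis using sum True by simp
  next
    case False
    have "q \<noteq> 1"
    proof
      assume "q = 1"
      then have "cos (2 * pi * of_int d / real N) = 1"
        by (simp add: q_def complex_eq_iff)
      then obtain z :: int where "2 * pi * of_int d / real N = of_int z * 2 * pi"
        using cos_one_2pi_int by blast
      then have "real_of_int d = of_int (z * int N)" using N by (simp add: field_simps)
      then have "d = z * int N" by (simp only: of_int_eq_iff)
      moreover have "\<bar>d\<bar> < int N" using assms by (auto simp: d_def)
      ultimately have "d = 0" using dvd_imp_le_int[of d "int N"] by fastforce
      then show False using False by (simp add: d_def)
    qed
    moreover have "q ^ N = 1"
    proof -
      have "q ^ N = cis (2 * pi * of_int d)" using N by (simp add: q_def DeMoivre)
      then show ?thesis by (simp add: cis_multiple_2pi)
    qed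
    ultimately show ?thesis using sum False geometric_sum[of q N] by simp
  qed
qed

definition shift_form :: "complex mat \<Rightarrow> nat \<Rightarrow> (nat \<Rightarrow> complex vec) \<Rightarrow> real" where
  "shift_form T p v = (\<Sum>i\<le>p. (vec_norm2 (v i))\<^sup>2) - Re (\<Sum>i<p. (T *\<^sub>v v i) \<bullet>c v (Suc i))"

text \<open>
  Testing the numerical radius on discrete Fourier sums of \<open>v\<close> and averaging over all frequencies
  leaves the diagonal inner products and those of neighbours.
\<close>
lemma shift_form_nonneg:
  assumes T: "numerical_contraction m T" and v: "\<And>i. i \<le> p \<Longrightarrow> v i \<in> carrier_vec m"
  shows "0 \<le> shift_form T p v"
proof -
  have Tc: "T \<in> carrier_mat m m" using T by (simp add: numerical_contraction_def)
  \<comment> \<open>The exponents \<open>Suc i\<close> and \<open>l\<close> range up to \<open>p + 1\<close>, so the order must exceed \<open>p + 1\<close>.\<close>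
  define N where "N = p + 2"
  define \<omega> where "\<omega> = cis (2 * pi / real N)"
  define y where "y j = lin_comb m p (\<lambda>i. (\<omega> ^ j) ^ i) v" for j
  have y: "y j \<in> carrier_vec m" for j by (simp add: y_def)
  have norm_\<omega>: "cmod (\<omega> ^ j) = 1" for j by (simp add: \<omega>_def norm_power)
  have orth: "(\<Sum>j<N. (\<omega> ^ j) ^ a * cnj ((\<omega> ^ j) ^ b)) = (if a = b then of_nat N else 0)"
    if "a \<le> Suc p" "b \<le> p" for a b
    using sum_roots_of_unity[of a b N] that by (simp add: \<omega>_def N_def)
  \<comment> \<open>Used with \<open>s i = i\<close> for the norms and with \<open>s i = Suc i\<close>, from the extra factor \<open>\<omega> ^ j\<close>, for neighbours.\<close>
  have average: "(\<Sum>j<N. \<Sum>i\<le>p. \<Sum>l\<le>p. (\<omega> ^ j) ^ s i * cnj ((\<omega> ^ j) ^ l) * z i l)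
      = of_nat N * (\<Sum>i\<le>p. \<Sum>l\<le>p. if s i = l then z i l else 0)"
    if "\<And>i. i \<le> p \<Longrightarrow> s i \<le> Suc p" for s :: "nat \<Rightarrow> nat" and z :: "nat \<Rightarrow> nat \<Rightarrow> complex"
  proof -
    have "(\<Sum>j<N. \<Sum>i\<le>p. \<Sum>l\<le>p. (\<omega> ^ j) ^ s i * cnj ((\<omega> ^ j) ^ l) * z i l)
        = (\<Sum>i\<le>p. \<Sum>j<N. \<Sum>l\<le>p. (\<omega> ^ j) ^ s i * cnj ((\<omega> ^ j) ^ l) * z i l)"
      by (rule sum.swap)
    also have "\<dots> = (\<Sum>i\<le>p. \<Sum>l\<le>p. \<Sum>j<N. (\<omega> ^ j) ^ s i * cnj ((\<omega> ^ j) ^ l) * z i l)"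
      by (intro sum.cong refl sum.swap)
    also have "\<dots> = (\<Sum>i\<le>p. \<Sum>l\<le>p. of_nat N * (if s i = l then z i l else 0))"
      using orth that
      by (intro sum.cong refl) (simp add: sum_distrib_right[symmetric] del: complex_cnj_power)
    finally show ?thesis by (simp only: sum_distrib_left)
  qed
  have "(\<Sum>j<N. y j \<bullet>c y j) = of_nat N * (\<Sum>i\<le>p. v i \<bullet>c v i)"
    unfolding y_def using average[of "\<lambda>i. i" "\<lambda>i l. v i \<bullet>c v l"]
    by (simp add: cscalar_prod_lin_comb v sum.delta)
  then have "Re (\<Sum>j<N. y j \<bullet>c y j) = real N * (\<Sum>i\<le>p. (vec_norm2 (v i))\<^sup>2)"
    using v by (simp add: cscalar_prod_self[where m = m])
  then have norms: "(\<Sum>j<N. (vec_norm2 (y j))\<^sup>2) = real N * (\<Sum>i\<le>p. (vec_norm2 (v i))\<^sup>2)"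
    by (simp add: cscalar_prod_self[OF y])
  have "(\<Sum>j<N. \<omega> ^ j * ((T *\<^sub>v y j) \<bullet>c y j))
      = of_nat N * (\<Sum>i\<le>p. \<Sum>l\<le>p. if Suc i = l then (T *\<^sub>v v i) \<bullet>c v l else 0)"
    unfolding y_def using average[of Suc "\<lambda>i l. (T *\<^sub>v v i) \<bullet>c v l"]
    by (simp add: mult_mat_lin_comb[OF Tc] cscalar_prod_lin_comb v sum_distrib_left mult_ac)
  also have "(\<Sum>i\<le>p. \<Sum>l\<le>p. if Suc i = l then (T *\<^sub>v v i) \<bullet>c v l else 0)
      = (\<Sum>i\<le>p. if i < p then (T *\<^sub>v v i) \<bullet>c v (Suc i) else 0)"
    by (intro sum.cong refl) (auto simp: sum.delta)
  also have "\<dots> = (\<Sum>i<p. (T *\<^sub>v v i) \<bullet>c v (Suc i))"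
    by (intro sum.mono_neutral_cong_right) auto
  finally have forms: "(\<Sum>j<N. \<omega> ^ j * ((T *\<^sub>v y j) \<bullet>c y j))
      = of_nat N * (\<Sum>i<p. (T *\<^sub>v v i) \<bullet>c v (Suc i))" .
  have "Re (\<Sum>j<N. \<omega> ^ j * ((T *\<^sub>v y j) \<bullet>c y j)) \<le> (\<Sum>j<N. (vec_norm2 (y j))\<^sup>2)"
    unfolding Re_sum
  proof (rule sum_mono)
    fix j
    have "Re (\<omega> ^ j * ((T *\<^sub>v y j) \<bullet>c y j)) \<le> cmod (\<omega> ^ j * ((T *\<^sub>v y j) \<bullet>c y j))"
      by (rule complex_Re_le_cmod)
    also have "\<dots> = cmod ((T *\<^sub>v y j) \<bullet>c y j)"
      by (simp only: norm_mult norm_\<omega>)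
    also have "\<dots> \<le> (vec_norm2 (y j))\<^sup>2"
      using T y by (simp add: numerical_contraction_def)
    finally show "Re (\<omega> ^ j * ((T *\<^sub>v y j) \<bullet>c y j)) \<le> (vec_norm2 (y j))\<^sup>2" .
  qed
  then have "real N * Re (\<Sum>i<p. (T *\<^sub>v v i) \<bullet>c v (Suc i))
      \<le> real N * (\<Sum>i\<le>p. (vec_norm2 (v i))\<^sup>2)"
    unfolding forms norms by simp
  then show ?thesis by (simp add: shift_form_def N_def)
qed

lemma shift_form_add:
  assumes T: "T \<in> carrier_mat m m"
    and v: "\<And>i. i \<le> p \<Longrightarrow> v i \<in> carrier_vec m" and w: "\<And>i. i \<le> p \<Longrightarrow> w i \<in> carrier_vec m"
  shows "shift_form T p (\<lambda>i. v i + w i) = shift_form T p v + shift_form T p w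
    + (\<Sum>i\<le>p. 2 * Re (w i \<bullet>c v i))
    - (\<Sum>i<p. Re ((T *\<^sub>v w i) \<bullet>c v (Suc i)) + Re (w (Suc i) \<bullet>c (T *\<^sub>v v i)))"
proof -
  have "(vec_norm2 (v i + w i))\<^sup>2 = (vec_norm2 (v i))\<^sup>2 + (vec_norm2 (w i))\<^sup>2 + 2 * Re (w i \<bullet>c v i)"
    if "i \<le> p" for i
  proof -
    have "complex_of_real ((vec_norm2 (v i + w i))\<^sup>2) = (v i + w i) \<bullet>c (v i + w i)"
      using v w that by (simp add: cscalar_prod_self[where m = m])
    also have "\<dots> = v i \<bullet>c v i + w i \<bullet>c w i + (w i \<bullet>c v i + v i \<bullet>c w i)"
      using v w that by (simp add: cscalar_prod_linear[where m = m])
    also have "v i \<bullet>c w i = cnj (w i \<bullet>c v i)"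
      using v w that by (intro cscalar_prod_commute) auto
    finally have "Re (complex_of_real ((vec_norm2 (v i + w i))\<^sup>2))
      = Re (v i \<bullet>c v i + w i \<bullet>c w i + (w i \<bullet>c v i + cnj (w i \<bullet>c v i)))" by (rule arg_cong)
    then show ?thesis
      using v[OF that] w[OF that] by (simp add: cscalar_prod_self[where m = m])
  qed
  then have norms: "(\<Sum>i\<le>p. (vec_norm2 (v i + w i))\<^sup>2)
      = (\<Sum>i\<le>p. (vec_norm2 (v i))\<^sup>2) + (\<Sum>i\<le>p. (vec_norm2 (w i))\<^sup>2) + (\<Sum>i\<le>p. 2 * Re (w i \<bullet>c v i))"
    by (simp add: sum.distrib)
  have "Re ((T *\<^sub>v (v i + w i)) \<bullet>c (v (Suc i) + w (Suc i)))
      = Re ((T *\<^sub>v v i) \<bullet>c v (Suc i)) + Re ((T *\<^sub>v w i) \<bullet>c w (Suc i))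
        + (Re ((T *\<^sub>v w i) \<bullet>c v (Suc i)) + Re (w (Suc i) \<bullet>c (T *\<^sub>v v i)))"
    if "i < p" for i
  proof -
    have c: "v i \<in> carrier_vec m" "w i \<in> carrier_vec m" "v (Suc i) \<in> carrier_vec m"
        "w (Suc i) \<in> carrier_vec m" "T *\<^sub>v v i \<in> carrier_vec m" "T *\<^sub>v w i \<in> carrier_vec m"
      using that v w T by auto
    have "w (Suc i) \<bullet>c (T *\<^sub>v v i) = cnj ((T *\<^sub>v v i) \<bullet>c w (Suc i))"
      using c by (intro cscalar_prod_commute) auto
    then show ?thesis
      using c by (simp add: mult_add_distrib_mat_vec[OF T] cscalar_prod_linear[where m = m])
  qed
  then have "(\<Sum>i<p. Re ((T *\<^sub>v (v i + w i)) \<bullet>c (v (Suc i) + w (Suc i))))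
      = (\<Sum>i<p. Re ((T *\<^sub>v v i) \<bullet>c v (Suc i))) + (\<Sum>i<p. Re ((T *\<^sub>v w i) \<bullet>c w (Suc i)))
        + (\<Sum>i<p. Re ((T *\<^sub>v w i) \<bullet>c v (Suc i)) + Re (w (Suc i) \<bullet>c (T *\<^sub>v v i)))"
    by (simp add: sum.distrib)
  with norms show ?thesis by (simp add: shift_form_def)
qed

text \<open>
  A zero of a nonnegative quadratic form is a stationary point. With \<open>g\<close> the negative gradient at
  position \<open>Suc j\<close>, moving that entry by \<open>t g\<close> changes the form by \<open>(t\<^sup>2 - t) \<parallel>g\<parallel>\<^sup>2\<close>; the step
  \<open>t = 1/2\<close> makes this negative unless \<open>g\<close> vanishes.
\<close>
lemma shift_form_zero_imp_stationary:
  assumes T: "numerical_contraction m T" and v: "\<And>i. i \<le> p \<Longrightarrow> v i \<in> carrier_vec m"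
    and zero: "shift_form T p v = 0" and j: "Suc j < p"
  shows "mat_adjoint T *\<^sub>v v (Suc (Suc j)) + T *\<^sub>v v j = 2 \<cdot>\<^sub>v v (Suc j)"
proof -
  have Tc: "T \<in> carrier_mat m m" using T by (simp add: numerical_contraction_def)
  have Tc': "mat_adjoint T \<in> carrier_mat m m" using Tc by simp
  define f where "f = mat_adjoint T *\<^sub>v v (Suc (Suc j)) + T *\<^sub>v v j"
  define g where "g = f + (-2) \<cdot>\<^sub>v v (Suc j)"
  define h where "h = (1 / 2) \<cdot>\<^sub>v g"
  define w where "w i = (if i = Suc j then h else 0\<^sub>v m)" for i
  have c: "v j \<in> carrier_vec m" "v (Suc j) \<in> carrier_vec m" "v (Suc (Suc j)) \<in> carrier_vec m"
    using j v by auto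
  have c': "mat_adjoint T *\<^sub>v v (Suc (Suc j)) \<in> carrier_vec m" "T *\<^sub>v v j \<in> carrier_vec m"
    using Tc Tc' c by auto
  have f: "f \<in> carrier_vec m" using c' by (simp add: f_def)
  have g: "g \<in> carrier_vec m" using f c by (simp add: g_def)
  have h: "h \<in> carrier_vec m" using g by (simp add: h_def)
  have w: "w i \<in> carrier_vec m" for i using h by (simp add: w_def)
  have norm0: "vec_norm2 (0\<^sub>v m) = 0" using vec_norm2_eq_0_iff[of "0\<^sub>v m" m] by simp
  have "(\<Sum>i\<le>p. (vec_norm2 (w i))\<^sup>2) = (\<Sum>i\<le>p. if i = Suc j then (vec_norm2 h)\<^sup>2 else 0)"
    by (intro sum.cong refl) (simp add: w_def norm0)
  then have n: "(\<Sum>i\<le>p. (vec_norm2 (w i))\<^sup>2) = (vec_norm2 h)\<^sup>2" using j by simp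
  have "(T *\<^sub>v w i) \<bullet>c w (Suc i) = 0" for i
    using h Tc by (auto simp: w_def cscalar_prod_linear[where m = m])
  then have form_w: "shift_form T p w = (vec_norm2 h)\<^sup>2" using n by (simp add: shift_form_def)
  have "(\<Sum>i\<le>p. 2 * Re (w i \<bullet>c v i)) = (\<Sum>i\<le>p. if i = Suc j then 2 * Re (h \<bullet>c v (Suc j)) else 0)"
    using v by (intro sum.cong refl) (simp add: w_def cscalar_prod_linear[where m = m])
  then have s1: "(\<Sum>i\<le>p. 2 * Re (w i \<bullet>c v i)) = 2 * Re (h \<bullet>c v (Suc j))" using j by simp
  have "(\<Sum>i<p. Re ((T *\<^sub>v w i) \<bullet>c v (Suc i)))
      = (\<Sum>i<p. if i = Suc j then Re ((T *\<^sub>v h) \<bullet>c v (Suc (Suc j))) else 0)"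
    using v Tc by (intro sum.cong refl) (auto simp: w_def cscalar_prod_linear[where m = m])
  then have s2: "(\<Sum>i<p. Re ((T *\<^sub>v w i) \<bullet>c v (Suc i))) = Re ((T *\<^sub>v h) \<bullet>c v (Suc (Suc j)))"
    using j by simp
  have "(\<Sum>i<p. Re (w (Suc i) \<bullet>c (T *\<^sub>v v i))) = (\<Sum>i<p. if i = j then Re (h \<bullet>c (T *\<^sub>v v j)) else 0)"
    using v Tc by (intro sum.cong refl) (auto simp: w_def intro!: cscalar_prod_zero_left)
  then have s3: "(\<Sum>i<p. Re (w (Suc i) \<bullet>c (T *\<^sub>v v i))) = Re (h \<bullet>c (T *\<^sub>v v j))"
    using j by simp
  have "shift_form T p (\<lambda>i. v i + w i) = (vec_norm2 h)\<^sup>2 + 2 * Re (h \<bullet>c v (Suc j))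
      - (Re ((T *\<^sub>v h) \<bullet>c v (Suc (Suc j))) + Re (h \<bullet>c (T *\<^sub>v v j)))"
    using shift_form_add[OF Tc, of p v w] v w by (simp only: zero form_w s1 sum.distrib s2 s3)
  also have "\<dots> = (vec_norm2 h)\<^sup>2 - Re (h \<bullet>c g)"
    using h c c' f by (simp add: g_def f_def cscalar_prod_adjoint[OF Tc] cscalar_prod_linear[where m = m])
  also have "h \<bullet>c g = complex_of_real ((vec_norm2 g)\<^sup>2 / 2)"
    unfolding h_def using g by (simp add: cscalar_prod_linear[where m = m] cscalar_prod_self)
  also have "(vec_norm2 h)\<^sup>2 = (vec_norm2 g)\<^sup>2 / 4"
    by (simp add: h_def vec_norm2_smult power_divide norm_divide)
  finally have "shift_form T p (\<lambda>i. v i + w i) = (vec_norm2 g)\<^sup>2 / 4 - (vec_norm2 g)\<^sup>2 / 2"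
    by simp
  moreover have "0 \<le> shift_form T p (\<lambda>i. v i + w i)"
    using v w by (intro shift_form_nonneg[OF T]) auto
  ultimately have "(vec_norm2 g)\<^sup>2 \<le> 0" by simp
  then have "g = 0\<^sub>v m" using vec_norm2_eq_0_iff[OF g] by simp
  then have "\<forall>i<m. (f + (-2) \<cdot>\<^sub>v v (Suc j)) $ i = 0" by (simp add: g_def)
  then have "f = 2 \<cdot>\<^sub>v v (Suc j)" using f c by (intro eq_vecI) auto
  then show ?thesis by (simp add: f_def)
qed

section \<open>The inequality of Crabb\<close>

lemma pow_mat_Suc_mult_vec:
  fixes T :: "complex mat"
  assumes T: "T \<in> carrier_mat m m" and x: "x \<in> carrier_vec m"
  shows "(T ^\<^sub>m Suc i) *\<^sub>v x = T *\<^sub>v ((T ^\<^sub>m i) *\<^sub>v x)"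
proof -
  have "T ^\<^sub>m Suc i = T * T ^\<^sub>m i"
  proof (induction i)
    case (Suc i)
    have "T ^\<^sub>m Suc (Suc i) = (T * T ^\<^sub>m i) * T" using Suc by simp
    also have "\<dots> = T * T ^\<^sub>m Suc i"
      using T by (simp add: assoc_mult_mat[OF T pow_carrier_mat[OF T] T])
    finally show ?case .
  qed (use T in simp)
  then show ?thesis
    using assoc_mult_mat_vec[OF T pow_carrier_mat[OF T] x] by simp
qed

text \<open>
  For \<open>k \<ge> 1\<close>, among the multiples of the last term its half minimizes \<open>shift_form\<close>: with factor
  \<open>a\<close> that term contributes \<open>(a\<^sup>2 - a) \<parallel>T\<^sup>k x\<parallel>\<^sup>2\<close>. The zeros beyond it allow padding.
\<close>
definition crabb_seq :: "complex mat \<Rightarrow> nat \<Rightarrow> complex vec \<Rightarrow> nat \<Rightarrow> complex vec" where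
  "crabb_seq T k x i =
     (if i < k then (T ^\<^sub>m i) *\<^sub>v x
      else if i = k then (1 / 2) \<cdot>\<^sub>v ((T ^\<^sub>m k) *\<^sub>v x)
      else 0\<^sub>v (dim_vec x))"

lemma crabb_seq_carrier [simp]:
  assumes "T \<in> carrier_mat m m" "x \<in> carrier_vec m"
  shows "crabb_seq T k x i \<in> carrier_vec m"
  using assms mult_mat_vec_in_carrier[OF pow_carrier_mat[OF assms(1)] assms(2)]
  by (simp add: crabb_seq_def)

text \<open>
  All intermediate norms cancel, because \<open>\<langle>T v\<^sub>i, v\<^sub>i\<^sub>+\<^sub>1\<rangle> = \<parallel>v\<^sub>i\<^sub>+\<^sub>1\<parallel>\<^sup>2\<close> below the last step.
\<close>
lemma shift_form_crabb_seq:
  assumes T: "T \<in> carrier_mat m m" and x: "x \<in> carrier_vec m" and k: "1 \<le> k"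
  shows "shift_form T k (crabb_seq T k x)
    = (vec_norm2 x)\<^sup>2 - (vec_norm2 ((T ^\<^sub>m k) *\<^sub>v x))\<^sup>2 / 4"
proof -
  obtain h where h: "k = Suc h" using k by (cases k) auto
  define y where "y i = (T ^\<^sub>m i) *\<^sub>v x" for i
  define t where "t i = (vec_norm2 (y i))\<^sup>2" for i
  have y: "y i \<in> carrier_vec m" for i
    unfolding y_def by (intro mult_mat_vec_in_carrier pow_carrier_mat T x)
  have Ty: "T *\<^sub>v y i = y (Suc i)" for i
    unfolding y_def by (rule pow_mat_Suc_mult_vec[OF T x, symmetric])
  have low: "crabb_seq T k x i = y i" if "i \<le> h" for i
    using that h by (simp add: crabb_seq_def y_def)
  have top: "crabb_seq T k x (Suc h) = (1 / 2) \<cdot>\<^sub>v y (Suc h)"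
    by (simp add: crabb_seq_def y_def h)
  have "(\<Sum>i\<le>k. (vec_norm2 (crabb_seq T k x i))\<^sup>2) = (\<Sum>i\<le>h. t i) + t (Suc h) / 4"
    unfolding h sum.atMost_Suc
    using low top unfolding h
    by (simp add: t_def vec_norm2_smult norm_divide power_divide)
  also have "(\<Sum>i\<le>h. t i) = t 0 + (\<Sum>i<h. t (Suc i))"
    by (rule sum.atMost_shift)
  finally have norms: "(\<Sum>i\<le>k. (vec_norm2 (crabb_seq T k x i))\<^sup>2)
      = t 0 + (\<Sum>i<h. t (Suc i)) + t (Suc h) / 4" .
  have "(\<Sum>i<k. (T *\<^sub>v crabb_seq T k x i) \<bullet>c crabb_seq T k x (Suc i))
      = (\<Sum>i<h. complex_of_real (t (Suc i))) + complex_of_real (t (Suc h)) / 2"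
    unfolding h sum.lessThan_Suc
    using low top unfolding h
    by (simp add: Ty t_def cscalar_prod_self[OF y] cscalar_prod_smult_right[OF y y])
  then have "Re (\<Sum>i<k. (T *\<^sub>v crabb_seq T k x i) \<bullet>c crabb_seq T k x (Suc i))
      = (\<Sum>i<h. t (Suc i)) + t (Suc h) / 2"
    by simp
  with norms have "shift_form T k (crabb_seq T k x) = t 0 - t (Suc h) / 4"
    by (simp add: shift_form_def)
  then show ?thesis using T x by (simp add: t_def y_def h)
qed

theorem crabb_inequality:
  assumes T: "numerical_contraction m T" and x: "x \<in> carrier_vec m" and k: "1 \<le> k"
  shows "vec_norm2 ((T ^\<^sub>m k) *\<^sub>v x) \<le> 2 * vec_norm2 x"
proof -
  have Tc: "T \<in> carrier_mat m m" using T by (simp add: numerical_contraction_def)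
  have "0 \<le> shift_form T k (crabb_seq T k x)"
    using Tc x by (intro shift_form_nonneg[OF T]) simp
  then have "(vec_norm2 ((T ^\<^sub>m k) *\<^sub>v x))\<^sup>2 \<le> (2 * vec_norm2 x)\<^sup>2"
    unfolding shift_form_crabb_seq[OF Tc x k] by (simp add: power_mult_distrib)
  then show ?thesis by (rule power2_le_imp_le) simp
qed

section \<open>Extremal vectors\<close>

text \<open>
  These are the stationarity equations of the extremal sequence, simplified by the known action of
  \<open>T\<close> on it. The first two, which stop the ladder at its ends, come from varying a zero entry just
  beyond the sequence.
\<close>
lemma crabb_extremal_relations:
  assumes T: "numerical_contraction m T" and x: "x \<in> carrier_vec m" and k: "1 \<le> k"
    and nx: "vec_norm2 x = 1" and nTx: "vec_norm2 ((T ^\<^sub>m k) *\<^sub>v x) = 2"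
  defines "v \<equiv> crabb_seq T k x"
  shows "T *\<^sub>v v k = 0\<^sub>v m"
    and "mat_adjoint T *\<^sub>v v 0 = 0\<^sub>v m"
    and "i < k \<Longrightarrow> T *\<^sub>v v i = (if Suc i = k then 2 else 1) \<cdot>\<^sub>v v (Suc i)"
    and "i < k \<Longrightarrow> mat_adjoint T *\<^sub>v v (Suc i) = (if i = 0 then 2 else 1) \<cdot>\<^sub>v v i"
proof -
  have Tc: "T \<in> carrier_mat m m" using T by (simp add: numerical_contraction_def)
  have Tc': "mat_adjoint T \<in> carrier_mat m m" using Tc by simp
  have v: "v i \<in> carrier_vec m" for i using Tc x by (simp add: v_def)
  have norm0: "vec_norm2 (0\<^sub>v m) = 0" using vec_norm2_eq_0_iff[of "0\<^sub>v m" m] by simp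
  have v_beyond: "v (Suc (k + i)) = 0\<^sub>v m" for i using x by (simp add: v_def crabb_seq_def)
  have zero: "shift_form T k v = 0"
    unfolding v_def shift_form_crabb_seq[OF Tc x k] nx nTx by simp
  \<comment> \<open>Two zeros on either side make the entries next to the sequence interior positions.\<close>
  define w where "w l = (if l < 2 then 0\<^sub>v m else v (l - 2))" for l
  have w: "w l \<in> carrier_vec m" for l using v by (simp add: w_def)
  have w01: "w 0 = 0\<^sub>v m" "w (Suc 0) = 0\<^sub>v m" and w2: "w (Suc (Suc l)) = v l" for l
    by (simp_all add: w_def)
  have "(\<Sum>l\<le>Suc (Suc (Suc (Suc k))). (vec_norm2 (w l))\<^sup>2) = (\<Sum>l\<le>k. (vec_norm2 (v l))\<^sup>2)"
    using v_beyond[of 0] v_beyond[of 1]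
    by (subst sum.atMost_Suc, subst sum.atMost_Suc)
      (simp add: w01 w2 norm0 sum.atMost_Suc_shift del: sum.atMost_Suc)
  moreover have "(\<Sum>l<Suc (Suc (Suc (Suc k))). (T *\<^sub>v w l) \<bullet>c w (Suc l))
      = (\<Sum>l<k. (T *\<^sub>v v l) \<bullet>c v (Suc l))"
    using v_beyond[of 0] v_beyond[of 1] Tc v
    by (subst sum.lessThan_Suc, subst sum.lessThan_Suc)
      (simp add: w01 w2 cscalar_prod_linear(5,6)[where m = m] mult_mat_vec_in_carrier
        sum.lessThan_Suc_shift del: sum.lessThan_Suc)
  ultimately have "shift_form T (Suc (Suc (Suc (Suc k)))) w = 0"
    using zero by (simp only: shift_form_def)
  then have stationary: "mat_adjoint T *\<^sub>v w (Suc (Suc j)) + T *\<^sub>v w j = 2 \<cdot>\<^sub>v w (Suc j)"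
    if "j < k + 3" for j
    using that by (intro shift_form_zero_imp_stationary[OF T w]) auto
  show "mat_adjoint T *\<^sub>v v 0 = 0\<^sub>v m"
    using stationary[of 0] Tc Tc' v by (simp add: w01 w2)
  have T_v: "T *\<^sub>v v i = (if Suc i = k then 2 else 1) \<cdot>\<^sub>v v (Suc i)" if "i < k" for i
  proof (cases "Suc i = k")
    case True
    then show ?thesis
      using pow_mat_Suc_mult_vec[OF Tc x, of i] by (simp add: v_def crabb_seq_def smult_smult_assoc)
  next
    case False
    then show ?thesis
      using that pow_mat_Suc_mult_vec[OF Tc x, of i] by (simp add: v_def crabb_seq_def)
  qed
  then show "i < k \<Longrightarrow> T *\<^sub>v v i = (if Suc i = k then 2 else 1) \<cdot>\<^sub>v v (Suc i)" .
  show "T *\<^sub>v v k = 0\<^sub>v m"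
    using stationary[of "Suc (Suc k)"] v_beyond[of 0] v_beyond[of 1] mult_mat_vec_in_carrier[OF Tc v]
    by (simp add: w2 mult_mat_zero_vec[OF Tc'])
  show "mat_adjoint T *\<^sub>v v (Suc i) = (if i = 0 then 2 else 1) \<cdot>\<^sub>v v i" if i: "i < k"
  proof (cases i)
    case 0
    then show ?thesis using stationary[of 1] Tc Tc' v by (simp add: w01 w2)
  next
    case (Suc l)
    have c: "mat_adjoint T *\<^sub>v v (Suc i) \<in> carrier_vec m" using Tc' v by auto
    have "mat_adjoint T *\<^sub>v v (Suc i) + v i = 2 \<cdot>\<^sub>v v i"
      using stationary[of "Suc (Suc l)"] i T_v[of l] by (simp add: w2 Suc)
    then have "\<forall>a<m. (mat_adjoint T *\<^sub>v v (Suc i) + v i) $ a = (2 \<cdot>\<^sub>v v i) $ a" by simp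
    then have "mat_adjoint T *\<^sub>v v (Suc i) = v i"
      using c v[of i] Tc by (intro eq_vecI) auto
    then show ?thesis using Suc by simp
  qed
qed

text \<open>
  The superdiagonal entry of \<open>ccc_mat k\<close> in row \<open>i\<close>, for \<open>i < k\<close>.
\<close>
definition ccc_weight :: "nat \<Rightarrow> nat \<Rightarrow> complex" where
  "ccc_weight k i = (if k = 1 then 2 else if i = 0 \<or> i + 1 = k then complex_of_real (sqrt 2) else 1)"

lemma ccc_weight_nonzero [simp]: "ccc_weight k i \<noteq> 0"
  by (simp add: ccc_weight_def)

lemma cnj_ccc_weight [simp]: "cnj (ccc_weight k i) = ccc_weight k i"
  by (simp add: ccc_weight_def)

definition orthonormal :: "nat \<Rightarrow> nat \<Rightarrow> (nat \<Rightarrow> complex vec) \<Rightarrow> bool" where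
  "orthonormal m p e \<longleftrightarrow> (\<forall>i<p. e i \<in> carrier_vec m) \<and>
     (\<forall>i<p. \<forall>j<p. e i \<bullet>c e j = (if i = j then 1 else 0))"

text \<open>
  Moving both entries one step along the ladder, by \<open>T\<close> on one side and its adjoint on the other,
  changes an inner product only by a factor \<open>\<gamma> j / \<gamma> i\<close>. Climbing until the later vector is at the
  top gives zero for distinct vectors and the norm of the top vector for equal ones.
\<close>
lemma orthonormal_ladder:
  assumes T: "T \<in> carrier_mat m m" and e: "\<And>i. i \<le> k \<Longrightarrow> e i \<in> carrier_vec m"
    and down: "\<And>i. i < k \<Longrightarrow> T *\<^sub>v e (Suc i) = \<gamma> i \<cdot>\<^sub>v e i"
    and top: "mat_adjoint T *\<^sub>v e k = 0\<^sub>v m"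
    and up: "\<And>i. i < k \<Longrightarrow> mat_adjoint T *\<^sub>v e i = cnj (\<gamma> i) \<cdot>\<^sub>v e (Suc i)"
    and \<gamma>: "\<And>i. i < k \<Longrightarrow> \<gamma> i \<noteq> 0" and unit: "vec_norm2 (e k) = 1"
  shows "orthonormal m (Suc k) e"
proof -
  have shift: "\<gamma> i * (e i \<bullet>c e j) = e (Suc i) \<bullet>c (mat_adjoint T *\<^sub>v e j)"
    if "i < k" "j \<le> k" for i j
  proof -
    have "\<gamma> i * (e i \<bullet>c e j) = (T *\<^sub>v e (Suc i)) \<bullet>c e j"
      using that e[of i] e[of j] by (simp add: down cscalar_prod_smult_left)
    also have "\<dots> = e (Suc i) \<bullet>c (mat_adjoint T *\<^sub>v e j)"
      using that e[of "Suc i"] e[of j] by (intro cscalar_prod_adjoint[OF T]) auto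
    finally show ?thesis .
  qed
  have upper: "e i \<bullet>c e j = (if i = j then 1 else 0)" if "i \<le> j" "j \<le> k" for i j
    using that(2,1)
  proof (induction j arbitrary: i rule: inc_induct)
    case base
    show ?case
    proof (cases "i = k")
      case True
      then show ?thesis using unit e[of k] by (simp add: cscalar_prod_self)
    next
      case False
      then have "\<gamma> i * (e i \<bullet>c e k) = 0"
        using shift[of i k] base e[of "Suc i"] by (simp add: top cscalar_prod_zero_right)
      then show ?thesis using \<gamma>[of i] False base by simp
    qed
  next
    case (step j)
    have "\<gamma> i * (e i \<bullet>c e j) = \<gamma> j * (e (Suc i) \<bullet>c e (Suc j))"
      using shift[of i j] step e[of "Suc i"] e[of "Suc j"]
      by (simp add: up cscalar_prod_smult_right[where m = m])
    then show ?case using step.IH[of "Suc i"] step \<gamma>[of i] by (auto split: if_splits)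
  qed
  have "e i \<bullet>c e j = (if i = j then 1 else 0)" if "i \<le> k" "j \<le> k" for i j
  proof (cases "i \<le> j")
    case False
    have "e i \<bullet>c e j = cnj (e j \<bullet>c e i)"
      using e that by (intro cscalar_prod_commute) auto
    also have "e j \<bullet>c e i = 0" using upper[of j i] False that by simp
    finally show ?thesis using False by simp
  qed (use upper that in blast)
  then show ?thesis using e by (simp add: orthonormal_def less_Suc_eq_le)
qed

text \<open>
  The vectors are those of \<open>crabb_seq\<close>, normalized and in reverse order: \<open>T\<close> climbs along the
  sequence but lowers the index in the basis of \<open>ccc_mat k\<close>.
\<close>
theorem crabb_extremal_structure:
  assumes T: "numerical_contraction m T" and x: "x \<in> carrier_vec m" and k: "1 \<le> k"
    and nx: "vec_norm2 x = 1" and nTx: "vec_norm2 ((T ^\<^sub>m k) *\<^sub>v x) = 2"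
  obtains e where "orthonormal m (Suc k) e"
    and "T *\<^sub>v e 0 = 0\<^sub>v m"
    and "\<And>i. i < k \<Longrightarrow> T *\<^sub>v e (Suc i) = ccc_weight k i \<cdot>\<^sub>v e i"
    and "mat_adjoint T *\<^sub>v e k = 0\<^sub>v m"
    and "\<And>i. i < k \<Longrightarrow> mat_adjoint T *\<^sub>v e i = ccc_weight k i \<cdot>\<^sub>v e (Suc i)"
proof -
  have Tc: "T \<in> carrier_mat m m" using T by (simp add: numerical_contraction_def)
  have Tc': "mat_adjoint T \<in> carrier_mat m m" using Tc by simp
  define v where "v = crabb_seq T k x"
  have v: "v i \<in> carrier_vec m" for i using Tc x by (simp add: v_def)
  note relations = crabb_extremal_relations[OF T x k nx nTx, folded v_def]
  \<comment> \<open>These are the norms that the entries of the sequence turn out to have.\<close>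
  define s where "s i = (if i = 0 \<or> i = k then 1 else complex_of_real (sqrt 2))" for i
  define e where "e j = (1 / s (k - j)) \<cdot>\<^sub>v v (k - j)" for j
  have e: "e j \<in> carrier_vec m" for j using v by (simp add: e_def)
  have s_nz: "s i \<noteq> 0" for i by (simp add: s_def)
  have sqrt2: "complex_of_real (sqrt 2) * complex_of_real (sqrt 2) = 2"
    by (simp flip: of_real_mult)
  have v_e: "v (k - j) = s (k - j) \<cdot>\<^sub>v e j" for j
    using s_nz by (simp add: e_def smult_smult_assoc)
  have e0: "T *\<^sub>v e 0 = 0\<^sub>v m"
    using relations(1) v by (simp add: e_def mult_mat_vec[OF Tc])
  have ek: "mat_adjoint T *\<^sub>v e k = 0\<^sub>v m"
    using relations(2) v by (simp add: e_def mult_mat_vec[OF Tc'])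
  have down: "T *\<^sub>v e (Suc j) = ccc_weight k j \<cdot>\<^sub>v e j" if j: "j < k" for j
  proof -
    define i where "i = k - Suc j"
    have i: "i < k" "k - j = Suc i" using j by (auto simp: i_def)
    have "T *\<^sub>v e (Suc j) = (1 / s i) \<cdot>\<^sub>v (T *\<^sub>v v i)"
      using v by (simp add: e_def i_def mult_mat_vec[OF Tc])
    also have "\<dots> = (1 / s i * (if Suc i = k then 2 else 1) * s (Suc i)) \<cdot>\<^sub>v e j"
      using relations(3)[OF i(1)] v_e[of j] i(2) by (simp add: smult_smult_assoc)
    also have "1 / s i * (if Suc i = k then 2 else 1) * s (Suc i) = ccc_weight k j"
      using i j sqrt2 by (auto simp: s_def ccc_weight_def divide_eq_eq)
    finally show ?thesis .
  qed
  have up: "mat_adjoint T *\<^sub>v e j = ccc_weight k j \<cdot>\<^sub>v e (Suc j)" if j: "j < k" for j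
  proof -
    define i where "i = k - Suc j"
    have i: "i < k" "k - j = Suc i" using j by (auto simp: i_def)
    have "mat_adjoint T *\<^sub>v e j = (1 / s (Suc i)) \<cdot>\<^sub>v (mat_adjoint T *\<^sub>v v (Suc i))"
      using v by (simp add: e_def i(2) mult_mat_vec[OF Tc'])
    also have "\<dots> = (1 / s (Suc i) * (if i = 0 then 2 else 1) * s i) \<cdot>\<^sub>v e (Suc j)"
      using relations(4)[OF i(1)] v_e[of "Suc j"] by (simp add: smult_smult_assoc flip: i_def)
    also have "1 / s (Suc i) * (if i = 0 then 2 else 1) * s i = ccc_weight k j"
      using i j sqrt2 by (auto simp: s_def ccc_weight_def divide_eq_eq)
    finally show ?thesis .
  qed
  have "e k = x" using k x Tc by (simp add: e_def s_def v_def crabb_seq_def)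
  then have "orthonormal m (Suc k) e"
    using nx by (intro orthonormal_ladder[OF Tc e down ek]) (simp_all add: up)
  then show thesis using that e0 down ek up by blast
qed

section \<open>Orthonormal frames and compressions\<close>

lemma orthonormal_extend_one:
  assumes e: "orthonormal m p e" and p: "p < m"
  obtains u where "orthonormal m (Suc p) (e(p := u))"
proof -
  have ec: "e i \<in> carrier_vec m" if "i < p" for i using e that by (simp add: orthonormal_def)
  \<comment> \<open>A square matrix with a zero row is singular; its kernel contains a vector orthogonal to the frame.\<close>
  define M where "M = mat\<^sub>r m m (\<lambda>i. if i = p then 0\<^sub>v m
      else if i < p then conjugate (e i) else 0\<^sub>v m)"
  have M: "M \<in> carrier_mat m m" by (simp add: M_def)
  have "det M = 0" unfolding M_def using ec by (intro det_row_0[OF p]) auto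
  then obtain v where v: "v \<in> carrier_vec m" "v \<noteq> 0\<^sub>v m" and Mv: "M *\<^sub>v v = 0\<^sub>v m"
    using det_0_iff_vec_prod_zero[OF M] by blast
  have orth: "v \<bullet>c e i = 0" if i: "i < p" for i
  proof -
    have "row M i = conjugate (e i)" using i p ec[OF i] by (simp add: M_def)
    then have "conjugate (e i) \<bullet> v = (M *\<^sub>v v) $ i" using i p M by simp
    then show ?thesis using Mv i p conjugate_vec_sprod_comm[OF v(1) ec[OF i]] by simp
  qed
  define u where "u = complex_of_real (1 / vec_norm2 v) \<cdot>\<^sub>v v"
  have u: "u \<in> carrier_vec m" "vec_norm2 u = 1"
    using normalize_in_unit_vecs[OF v] by (auto simp: u_def unit_vecs_def)
  have u_e: "u \<bullet>c e i = 0" if "i < p" for i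
    using orth[OF that] v ec[OF that] by (simp add: u_def cscalar_prod_smult_left)
  have e_u: "e i \<bullet>c u = 0" if "i < p" for i
    using u_e[OF that] cscalar_prod_commute[OF u(1) ec[OF that]] by simp
  have "u \<bullet>c u = 1" using u by (simp add: cscalar_prod_self)
  then have "orthonormal m (Suc p) (e(p := u))"
    using e u u_e e_u by (auto simp: orthonormal_def less_Suc_eq)
  then show thesis by (rule that)
qed

lemma orthonormal_extend:
  assumes "orthonormal m p e" "p \<le> m"
  obtains e' where "orthonormal m m e'" "\<And>i. i < p \<Longrightarrow> e' i = e i"
proof -
  have "\<exists>e'. orthonormal m m e' \<and> (\<forall>i<p. e' i = e i)"
    using assms(2,1)
  proof (induction p arbitrary: e rule: inc_induct)
    case (step p)
    obtain u where "orthonormal m (Suc p) (e(p := u))"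
      using orthonormal_extend_one[OF step.prems] step.hyps by blast
    then obtain e' where "orthonormal m m e'" "\<forall>i<Suc p. e' i = (e(p := u)) i"
      using step.IH by blast
    then show ?case by (intro exI[of _ e']) auto
  qed blast
  then show thesis using that by blast
qed

definition frame_mat :: "nat \<Rightarrow> nat \<Rightarrow> (nat \<Rightarrow> complex vec) \<Rightarrow> complex mat" where
  "frame_mat m l e = mat m l (\<lambda>(a, j). e j $ a)"

lemma frame_mat_carrier [simp]: "frame_mat m l e \<in> carrier_mat m l"
  by (simp add: frame_mat_def)

lemma dim_frame_mat [simp]:
  "dim_row (frame_mat m l e) = m" "dim_col (frame_mat m l e) = l"
  by (simp_all add: frame_mat_def)

lemma col_frame_mat:
  assumes "j < l" "e j \<in> carrier_vec m"
  shows "col (frame_mat m l e) j = e j"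
  using assms by (intro eq_vecI) (auto simp: frame_mat_def)

lemma row_adjoint_frame_mat:
  assumes "i < l" "e i \<in> carrier_vec m"
  shows "row (mat_adjoint (frame_mat m l e)) i = conjugate (e i)"
proof -
  have "mat_adjoint (frame_mat m l e) \<in> carrier_mat l m" by simp
  then show ?thesis
    using assms by (intro eq_vecI) (auto simp: index_mat_adjoint frame_mat_def)
qed

lemma frame_mat_gram:
  assumes "orthonormal m l e"
  shows "mat_adjoint (frame_mat m l e) * frame_mat m l e = 1\<^sub>m l"
proof -
  let ?P = "frame_mat m l e"
  have P': "mat_adjoint ?P \<in> carrier_mat l m" by simp
  have P: "?P \<in> carrier_mat m l" by simp
  have e: "e i \<in> carrier_vec m" if "i < l" for i using assms that by (simp add: orthonormal_def)
  have "(mat_adjoint ?P * ?P) $$ (i, j) = 1\<^sub>m l $$ (i, j)" if ij: "i < l" "j < l" for i j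
  proof -
    have "(mat_adjoint ?P * ?P) $$ (i, j) = conjugate (e i) \<bullet> e j"
      using P' P ij e by (simp add: index_mult_mat row_adjoint_frame_mat col_frame_mat)
    also have "\<dots> = e j \<bullet>c e i" using conjugate_vec_sprod_comm[of "e j" m "e i"] e ij by simp
    also have "\<dots> = (if i = j then 1 else 0)" using assms ij by (auto simp: orthonormal_def)
    finally show ?thesis using ij by simp
  qed
  then show ?thesis using P P' by (intro eq_matI) auto
qed

lemma frame_mat_unitary:
  assumes "orthonormal m m e"
  shows "unitary_mat m (frame_mat m m e)"
  using frame_mat_gram[OF assms] mat_mult_left_right_inverse[of "mat_adjoint (frame_mat m m e)" m]
  by (simp add: unitary_mat_def)

lemma index_frame_mat_compression:
  assumes T: "T \<in> carrier_mat m m" and e: "\<And>i. i < l \<Longrightarrow> e i \<in> carrier_vec m"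
    and ij: "i < l" "j < l"
  shows "(mat_adjoint (frame_mat m l e) * T * frame_mat m l e) $$ (i, j) = (T *\<^sub>v e j) \<bullet>c e i"
proof -
  let ?P = "frame_mat m l e"
  have P': "mat_adjoint ?P \<in> carrier_mat l m" by simp
  have P: "?P \<in> carrier_mat m l" by simp
  have Te: "T *\<^sub>v e j \<in> carrier_vec m" using T e ij by auto
  have "mat_adjoint ?P * T * ?P = mat_adjoint ?P * (T * ?P)"
    by (rule assoc_mult_mat[OF P' T P])
  also have "(mat_adjoint ?P * (T * ?P)) $$ (i, j) = conjugate (e i) \<bullet> (T *\<^sub>v e j)"
    using T ij e by (simp add: row_adjoint_frame_mat col_mult2[OF T P] col_frame_mat)
  also have "\<dots> = (T *\<^sub>v e j) \<bullet>c e i"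
    using conjugate_vec_sprod_comm[OF Te e[OF ij(1)]] by simp
  finally show ?thesis .
qed

lemma isometry_norm:
  assumes P: "P \<in> carrier_mat m l" and iso: "mat_adjoint P * P = 1\<^sub>m l" and u: "u \<in> carrier_vec l"
  shows "vec_norm2 (P *\<^sub>v u) = vec_norm2 u"
proof -
  have P': "mat_adjoint P \<in> carrier_mat l m" using P by simp
  have Pu: "P *\<^sub>v u \<in> carrier_vec m" using P u by simp
  have "(P *\<^sub>v u) \<bullet>c (P *\<^sub>v u) = u \<bullet>c ((mat_adjoint P * P) *\<^sub>v u)"
    using cscalar_prod_adjoint[OF P u Pu] assoc_mult_mat_vec[OF P' P u] by simp
  then have "complex_of_real ((vec_norm2 (P *\<^sub>v u))\<^sup>2) = complex_of_real ((vec_norm2 u)\<^sup>2)"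
    using u by (simp add: iso cscalar_prod_self[OF Pu] cscalar_prod_self[OF u])
  then have "(vec_norm2 (P *\<^sub>v u))\<^sup>2 = (vec_norm2 u)\<^sup>2" by (simp only: of_real_eq_iff)
  then show ?thesis by (simp add: power2_eq_iff_nonneg)
qed

lemma numerical_contraction_compression:
  assumes T: "numerical_contraction m T" and P: "P \<in> carrier_mat m l"
    and iso: "mat_adjoint P * P = 1\<^sub>m l"
  shows "numerical_contraction l (mat_adjoint P * T * P)"
  unfolding numerical_contraction_def
proof (intro conjI ballI)
  have Tc: "T \<in> carrier_mat m m" using T by (simp add: numerical_contraction_def)
  have P': "mat_adjoint P \<in> carrier_mat l m" using P by simp
  show "mat_adjoint P * T * P \<in> carrier_mat l l"
    by (rule mult_carrier_mat[OF mult_carrier_mat[OF P' Tc] P])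
  fix u :: "complex vec" assume u: "u \<in> carrier_vec l"
  have Pu: "P *\<^sub>v u \<in> carrier_vec m" using P u by simp
  have TPu: "T *\<^sub>v (P *\<^sub>v u) \<in> carrier_vec m" using Tc Pu by simp
  have "(mat_adjoint P * T * P) *\<^sub>v u = mat_adjoint P *\<^sub>v (T *\<^sub>v (P *\<^sub>v u))"
    using assoc_mult_mat_vec[OF mult_carrier_mat[OF P' Tc] P u] assoc_mult_mat_vec[OF P' Tc Pu] by simp
  moreover have "(T *\<^sub>v (P *\<^sub>v u)) \<bullet>c (P *\<^sub>v u) = (mat_adjoint P *\<^sub>v (T *\<^sub>v (P *\<^sub>v u))) \<bullet>c u"
  proof -
    have "(T *\<^sub>v (P *\<^sub>v u)) \<bullet>c (P *\<^sub>v u) = cnj ((P *\<^sub>v u) \<bullet>c (T *\<^sub>v (P *\<^sub>v u)))"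
      by (rule cscalar_prod_commute[OF Pu TPu])
    also have "(P *\<^sub>v u) \<bullet>c (T *\<^sub>v (P *\<^sub>v u)) = u \<bullet>c (mat_adjoint P *\<^sub>v (T *\<^sub>v (P *\<^sub>v u)))"
      by (rule cscalar_prod_adjoint[OF P u TPu])
    also have "cnj \<dots> = (mat_adjoint P *\<^sub>v (T *\<^sub>v (P *\<^sub>v u))) \<bullet>c u"
      using P' TPu u by (intro cscalar_prod_commute[symmetric]) auto
    finally show ?thesis .
  qed
  moreover have "cmod ((T *\<^sub>v (P *\<^sub>v u)) \<bullet>c (P *\<^sub>v u)) \<le> (vec_norm2 (P *\<^sub>v u))\<^sup>2"
    using T Pu by (simp add: numerical_contraction_def)
  ultimately show "cmod (((mat_adjoint P * T * P) *\<^sub>v u) \<bullet>c u) \<le> (vec_norm2 u)\<^sup>2"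
    by (simp add: isometry_norm[OF P iso u])
qed

lemma numerical_contraction_norm_bounds:
  assumes B: "numerical_contraction l B" and l: "0 < l" and k: "1 \<le> k"
  shows "numerical_radius B \<le> 1" and "mat_norm2 (B ^\<^sub>m k) \<le> 2"
proof -
  have Bc: "B \<in> carrier_mat l l" using B by (simp add: numerical_contraction_def)
  obtain \<zeta> where "\<zeta> \<in> field_of_values B" "numerical_radius B = cmod \<zeta>"
    using numerical_radius_attained(1)[OF Bc l] by blast
  then show "numerical_radius B \<le> 1"
    using B Bc by (force simp: field_of_values_def unit_vecs_def numerical_contraction_def)
  obtain z where "z \<in> unit_vecs l" "mat_norm2 (B ^\<^sub>m k) = vec_norm2 ((B ^\<^sub>m k) *\<^sub>v z)"
    using mat_norm2_attained(1)[OF pow_carrier_mat[OF Bc] l] by blast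
  then show "mat_norm2 (B ^\<^sub>m k) \<le> 2"
    using crabb_inequality[OF B _ k, of z] by (simp add: unit_vecs_def)
qed

section \<open>Normalization by the numerical radius\<close>

lemma smult_mat_mult_vec:
  fixes A :: "complex mat"
  assumes "A \<in> carrier_mat l m" "v \<in> carrier_vec m"
  shows "(c \<cdot>\<^sub>m A) *\<^sub>v v = c \<cdot>\<^sub>v (A *\<^sub>v v)"
  using assms by (intro eq_vecI) (auto simp: row_smult)

lemma pow_smult_mat:
  fixes A :: "complex mat"
  assumes A: "A \<in> carrier_mat m m"
  shows "(c \<cdot>\<^sub>m A) ^\<^sub>m k = c ^ k \<cdot>\<^sub>m (A ^\<^sub>m k)"
proof (induction k)
  case 0
  then show ?case using A by (intro eq_matI) auto
next
  case (Suc k)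
  have "(c \<cdot>\<^sub>m A) ^\<^sub>m Suc k = (c ^ k \<cdot>\<^sub>m (A ^\<^sub>m k)) * (c \<cdot>\<^sub>m A)" by (simp add: Suc)
  also have "\<dots> = c ^ k \<cdot>\<^sub>m (c \<cdot>\<^sub>m (A ^\<^sub>m k * A))"
    using mult_smult_assoc_mat[OF pow_carrier_mat[OF A] smult_carrier_mat[OF A]]
      mult_smult_distrib[OF pow_carrier_mat[OF A] A] by simp
  also have "\<dots> = c ^ Suc k \<cdot>\<^sub>m (A ^\<^sub>m Suc k)" by (intro eq_matI) auto
  finally show ?case .
qed

lemma numerical_contraction_scaled:
  assumes A: "A \<in> carrier_mat m m" and c: "cmod c * numerical_radius A \<le> 1"
  shows "numerical_contraction m (c \<cdot>\<^sub>m A)"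
  unfolding numerical_contraction_def
proof (intro conjI ballI)
  show "c \<cdot>\<^sub>m A \<in> carrier_mat m m" using A by simp
  fix v :: "complex vec" assume v: "v \<in> carrier_vec m"
  have "cmod (((c \<cdot>\<^sub>m A) *\<^sub>v v) \<bullet>c v) = cmod c * cmod ((A *\<^sub>v v) \<bullet>c v)"
    using smult_mat_mult_vec[OF A v] cscalar_prod_smult_left[OF mult_mat_vec_in_carrier[OF A v] v]
    by (simp add: norm_mult)
  also have "\<dots> \<le> cmod c * (numerical_radius A * (vec_norm2 v)\<^sup>2)"
    by (intro mult_left_mono numerical_radius_bound[OF A v]) simp
  also have "\<dots> = (cmod c * numerical_radius A) * (vec_norm2 v)\<^sup>2" by simp
  also have "\<dots> \<le> 1 * (vec_norm2 v)\<^sup>2" by (intro mult_right_mono c) simp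
  finally show "cmod (((c \<cdot>\<^sub>m A) *\<^sub>v v) \<bullet>c v) \<le> (vec_norm2 v)\<^sup>2" by simp
qed

text \<open>
  If the numerical radius vanished, every positive multiple \<open>t A\<close> would satisfy Crabb's inequality
  with exponent 1, which bounds \<open>t \<parallel>A x\<parallel>\<close> by \<open>2 \<parallel>x\<parallel>\<close> for all \<open>t\<close>.
\<close>
lemma numerical_radius_pos:
  assumes A: "A \<in> carrier_mat m m" and nz: "A \<noteq> 0\<^sub>m m m"
  shows "0 < numerical_radius A"
proof (rule ccontr)
  assume not_pos: "\<not> 0 < numerical_radius A"
  have "A *\<^sub>v x = 0\<^sub>v m" if x: "x \<in> carrier_vec m" for x
  proof -
    have "vec_norm2 (A *\<^sub>v x) = 0"
    proof (rule ccontr)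
      assume "vec_norm2 (A *\<^sub>v x) \<noteq> 0"
      then have pos: "0 < vec_norm2 (A *\<^sub>v x)" using vec_norm2_nonneg[of "A *\<^sub>v x"] by linarith
      \<comment> \<open>Any factor exceeding \<open>2 \<parallel>x\<parallel> / \<parallel>A x\<parallel>\<close> gives the contradiction.\<close>
      define t where "t = (2 * vec_norm2 x + 1) / vec_norm2 (A *\<^sub>v x)"
      have "0 < t" unfolding t_def using pos vec_norm2_nonneg[of x]
        by (intro divide_pos_pos) linarith+
      then have "t * numerical_radius A \<le> 0" using not_pos by (simp add: mult_nonneg_nonpos)
      then have contr: "numerical_contraction m (complex_of_real t \<cdot>\<^sub>m A)"
        using \<open>0 < t\<close> by (intro numerical_contraction_scaled[OF A]) simp
      have "vec_norm2 ((complex_of_real t \<cdot>\<^sub>m A) *\<^sub>v x) \<le> 2 * vec_norm2 x"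
        using crabb_inequality[OF contr x, of 1] A by simp
      moreover have "vec_norm2 ((complex_of_real t \<cdot>\<^sub>m A) *\<^sub>v x) = t * vec_norm2 (A *\<^sub>v x)"
        using \<open>0 < t\<close> by (simp add: smult_mat_mult_vec[OF A x] vec_norm2_smult)
      moreover have "t * vec_norm2 (A *\<^sub>v x) = 2 * vec_norm2 x + 1" using pos by (simp add: t_def)
      ultimately show False by simp
    qed
    then show ?thesis
      using vec_norm2_eq_0_iff[OF mult_mat_vec_in_carrier[OF A x]] by simp
  qed
  then have zero: "A *\<^sub>v unit_vec m j = 0\<^sub>v m" for j by simp
  have "A $$ (i, j) = 0" if "i < m" "j < m" for i j
  proof -
    have "A $$ (i, j) = (A *\<^sub>v unit_vec m j) $ i" using A that by simp
    then show ?thesis using zero that by simp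
  qed
  then have "A = 0\<^sub>m m m" using A by (intro eq_matI) auto
  then show False using nz by simp
qed

lemma norm_pow_le_numerical_radius:
  assumes A: "A \<in> carrier_mat m m" and r: "0 < numerical_radius A"
    and x: "x \<in> carrier_vec m" and k: "1 \<le> k"
  shows "vec_norm2 ((A ^\<^sub>m k) *\<^sub>v x) \<le> 2 * numerical_radius A ^ k * vec_norm2 x"
proof -
  define c where "c = complex_of_real (1 / numerical_radius A)"
  have "numerical_contraction m (c \<cdot>\<^sub>m A)"
    using r by (intro numerical_contraction_scaled[OF A]) (simp add: c_def norm_divide)
  then have "vec_norm2 (((c \<cdot>\<^sub>m A) ^\<^sub>m k) *\<^sub>v x) \<le> 2 * vec_norm2 x"
    by (rule crabb_inequality[OF _ x k])
  also have "((c \<cdot>\<^sub>m A) ^\<^sub>m k) *\<^sub>v x = c ^ k \<cdot>\<^sub>v ((A ^\<^sub>m k) *\<^sub>v x)"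
    by (simp add: pow_smult_mat[OF A] smult_mat_mult_vec[OF pow_carrier_mat[OF A] x])
  finally show ?thesis
    using r by (simp add: c_def vec_norm2_smult norm_power norm_divide power_divide field_simps)
qed

section \<open>Matrices whose power has the largest possible norm\<close>

lemma index_diag_ccc_block:
  assumes B: "B \<in> carrier_mat l l" and i: "i < Suc k + l" and j: "j < Suc k + l"
  shows "diag_block_mat [ccc_mat k, B] $$ (i, j) =
    (if j \<le> k then if j = Suc i then ccc_weight k i else 0
     else if i \<le> k then 0 else B $$ (i - Suc k, j - Suc k))"
  using assms
  by (auto simp: ccc_mat_def ccc_weight_def Let_def)

lemma dim_diag_ccc_block:
  assumes "B \<in> carrier_mat l l"
  shows "diag_block_mat [ccc_mat k, B] \<in> carrier_mat (Suc k + l) (Suc k + l)"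
  using assms by (auto simp: ccc_mat_def Let_def)

text \<open>
  The extremal ladder spans a reducing subspace: relations for \<open>T\<close> give the first columns of the
  block form, relations for the adjoint give the first rows.
\<close>
lemma norm_eq_imp_ccc_block:
  assumes A: "A \<in> carrier_mat (n + 1) (n + 1)" and r: "0 < numerical_radius A"
    and k: "1 \<le> k" "k \<le> n" and norm: "mat_norm2 (A ^\<^sub>m k) = 2 * numerical_radius A ^ k"
  shows "\<exists>B \<in> carrier_mat (n - k) (n - k). numerical_contraction (n - k) B \<and>
    unitarily_similar A
      (complex_of_real (numerical_radius A) \<cdot>\<^sub>m diag_block_mat [ccc_mat k, B])"
proof -
  let ?r = "numerical_radius A" and ?m = "Suc n"
  define T where "T = complex_of_real (1 / ?r) \<cdot>\<^sub>m A"
  have Ac: "A \<in> carrier_mat ?m ?m" using A by simp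
  have T: "numerical_contraction ?m T"
    unfolding T_def using r by (intro numerical_contraction_scaled[OF Ac]) (simp add: norm_divide)
  then have Tc: "T \<in> carrier_mat ?m ?m" by (simp add: numerical_contraction_def)
  have A_T: "A = complex_of_real ?r \<cdot>\<^sub>m T" using r A unfolding T_def by (intro eq_matI) auto
  obtain x where x: "x \<in> unit_vecs ?m" "vec_norm2 ((A ^\<^sub>m k) *\<^sub>v x) = 2 * ?r ^ k"
    using mat_norm2_attained(1)[OF pow_carrier_mat[OF Ac], of k] norm by auto
  have xc: "x \<in> carrier_vec ?m" "vec_norm2 x = 1" using x by (auto simp: unit_vecs_def)
  have "vec_norm2 ((T ^\<^sub>m k) *\<^sub>v x) = (1 / ?r) ^ k * (2 * ?r ^ k)"
    unfolding T_def pow_smult_mat[OF Ac] smult_mat_mult_vec[OF pow_carrier_mat[OF Ac] xc(1)]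
    using r x by (simp add: vec_norm2_smult norm_power norm_divide)
  then have "vec_norm2 ((T ^\<^sub>m k) *\<^sub>v x) = 2" using r by (simp add: power_divide)
  then obtain e0 where e0: "orthonormal ?m (Suc k) e0" "T *\<^sub>v e0 0 = 0\<^sub>v ?m"
      "\<And>i. i < k \<Longrightarrow> T *\<^sub>v e0 (Suc i) = ccc_weight k i \<cdot>\<^sub>v e0 i"
      "mat_adjoint T *\<^sub>v e0 k = 0\<^sub>v ?m"
      "\<And>i. i < k \<Longrightarrow> mat_adjoint T *\<^sub>v e0 i = ccc_weight k i \<cdot>\<^sub>v e0 (Suc i)"
    using crabb_extremal_structure[OF T xc(1) k(1) xc(2)] by metis
  obtain e where e: "orthonormal ?m ?m e" and "\<And>i. i < Suc k \<Longrightarrow> e i = e0 i"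
    using orthonormal_extend[OF e0(1)] k by auto
  with e0(2-) have bottom: "T *\<^sub>v e 0 = 0\<^sub>v ?m"
    and down: "\<And>i. i < k \<Longrightarrow> T *\<^sub>v e (Suc i) = ccc_weight k i \<cdot>\<^sub>v e i"
    and top: "mat_adjoint T *\<^sub>v e k = 0\<^sub>v ?m"
    and up: "\<And>i. i < k \<Longrightarrow> mat_adjoint T *\<^sub>v e i = ccc_weight k i \<cdot>\<^sub>v e (Suc i)"
    by simp_all
  have ec: "e i \<in> carrier_vec ?m" if "i < ?m" for i using e that by (simp add: orthonormal_def)
  have ee: "e i \<bullet>c e j = (if i = j then 1 else 0)" if "i < ?m" "j < ?m" for i j
    using e that by (simp add: orthonormal_def)
  define Q where "Q = frame_mat ?m ?m e"
  define P where "P = frame_mat ?m (n - k) (\<lambda>j. e (j + Suc k))"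
  define B where "B = mat_adjoint P * T * P"
  have Q: "Q \<in> carrier_mat ?m ?m" and Q': "mat_adjoint Q \<in> carrier_mat ?m ?m" by (simp_all add: Q_def)
  have "orthonormal ?m (n - k) (\<lambda>j. e (j + Suc k))"
    using e by (auto simp: orthonormal_def)
  then have Bcontr: "numerical_contraction (n - k) B"
    unfolding B_def P_def
    by (intro numerical_contraction_compression[OF T] frame_mat_gram) simp_all
  then have Bc: "B \<in> carrier_mat (n - k) (n - k)" by (simp add: numerical_contraction_def)
  define D where "D = diag_block_mat [ccc_mat k, B]"
  have D: "D \<in> carrier_mat ?m ?m"
    unfolding D_def using dim_diag_ccc_block[OF Bc, of k] k by simp
  have "mat_adjoint Q * T * Q = D"
  proof (rule eq_matI)
    fix i j assume "i < dim_row (D)" "j < dim_col (D)"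
    then have ij: "i < ?m" "j < ?m" using D by auto
    have entry: "(mat_adjoint Q * T * Q) $$ (i, j) = (T *\<^sub>v e j) \<bullet>c e i"
      unfolding Q_def by (rule index_frame_mat_compression[OF Tc ec ij])
    have block: "D $$ (i, j) =
      (if j \<le> k then if j = Suc i then ccc_weight k i else 0
       else if i \<le> k then 0 else B $$ (i - Suc k, j - Suc k))"
      unfolding D_def using k ij by (intro index_diag_ccc_block[OF Bc]) auto
    consider (C0) "j = 0" | (C) l where "j = Suc l" "l < k" | (U) "k < j" "i \<le> k" | (B) "k < j" "k < i"
      using not_less by (cases j) force+
    then have "(T *\<^sub>v e j) \<bullet>c e i = D $$ (i, j)"
    proof cases
      case C0
      then show ?thesis
        unfolding block using bottom ec[OF ij(1)] by (simp add: cscalar_prod_zero_left)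
    next
      case (C l)
      have "(T *\<^sub>v e j) \<bullet>c e i = ccc_weight k l * (e l \<bullet>c e i)"
        using down[OF C(2)] C ec[of l] ec[OF ij(1)] ij by (simp add: cscalar_prod_smult_left)
      then show ?thesis
        unfolding block using C ij ee[of l i] by simp
    next
      case U
      have "(T *\<^sub>v e j) \<bullet>c e i = e j \<bullet>c (mat_adjoint T *\<^sub>v e i)"
        using ec ij by (intro cscalar_prod_adjoint[OF Tc]) auto
      also have "\<dots> = 0"
      proof (cases "i = k")
        case True
        then show ?thesis using top ec[OF ij(2)] by (simp add: cscalar_prod_zero_right)
      next
        case False
        then have i: "i < k" using U by simp
        then show ?thesis
          using up[OF i] ec[OF ij(2)] ec[of "Suc i"] ee[of j "Suc i"] U k ij
          by (simp add: cscalar_prod_smult_right)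
      qed
      finally show ?thesis unfolding block using U by simp
    next
      case B
      have "B $$ (i - Suc k, j - Suc k) = (T *\<^sub>v e (j - Suc k + Suc k)) \<bullet>c e (i - Suc k + Suc k)"
        unfolding B_def P_def
        using B ij by (intro index_frame_mat_compression[OF Tc]) (auto intro: ec)
      then show ?thesis unfolding block using B by simp
    qed
    then show "(mat_adjoint Q * T * Q) $$ (i, j) = D $$ (i, j)"
      using entry by simp
  qed (use carrier_matD[OF Q] carrier_matD[OF D] in simp_all)
  then have "complex_of_real ?r \<cdot>\<^sub>m D = complex_of_real ?r \<cdot>\<^sub>m (mat_adjoint Q * T * Q)"
    by simp
  also have "\<dots> = mat_adjoint Q * (complex_of_real ?r \<cdot>\<^sub>m T) * Q"
    using mult_smult_distrib[OF Q' Tc] mult_smult_assoc_mat[OF mult_carrier_mat[OF Q' Tc] Q] by simp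
  finally have "complex_of_real ?r \<cdot>\<^sub>m D = mat_adjoint Q * A * Q"
    by (simp flip: A_T)
  moreover have "unitary_mat ?m Q" unfolding Q_def by (rule frame_mat_unitary[OF e])
  ultimately have "unitarily_similar A (complex_of_real ?r \<cdot>\<^sub>m D)"
    unfolding unitarily_similar_def using Ac smult_carrier_mat[OF D] by blast
  then show ?thesis using Bc Bcontr unfolding D_def by blast
qed

text \<open>
  The ladder of \<open>ccc_mat k\<close> starts at the basis vector with index \<open>k\<close>; descending all the way to
  index 0 multiplies it by the product of all weights, which is 2, and by \<open>r ^ k\<close>.
\<close>
lemma ccc_block_imp_norm_ge:
  assumes A: "A \<in> carrier_mat (n + 1) (n + 1)" and r: "0 < r" and k: "1 \<le> k" "k \<le> n"
    and B: "B \<in> carrier_mat (n - k) (n - k)"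
    and sim: "unitarily_similar A (complex_of_real r \<cdot>\<^sub>m diag_block_mat [ccc_mat k, B])"
  shows "2 * r ^ k \<le> mat_norm2 (A ^\<^sub>m k)"
proof -
  let ?m = "Suc n" 
  define D where "D = diag_block_mat [ccc_mat k, B]"
  let ?N = "complex_of_real r \<cdot>\<^sub>m D"
  have Ac: "A \<in> carrier_mat ?m ?m" using A by simp
  have D: "D \<in> carrier_mat ?m ?m"
    unfolding D_def using dim_diag_ccc_block[OF B, of k] k by simp
  obtain m' Q where "A \<in> carrier_mat m' m'" "unitary_mat m' Q"
    and N: "?N = mat_adjoint Q * A * Q"
    using sim unfolding D_def unitarily_similar_def by blast
  moreover from this Ac have "m' = ?m" by (metis carrier_matD(1))
  ultimately have unitary: "unitary_mat ?m Q" by simp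
  have Q: "Q \<in> carrier_mat ?m ?m" and QQ: "mat_adjoint Q * Q = 1\<^sub>m ?m" "Q * mat_adjoint Q = 1\<^sub>m ?m"
    using unitary by (auto simp: unitary_mat_def)
  have Q': "mat_adjoint Q \<in> carrier_mat ?m ?m" using Q by simp
  have "Q * ?N = Q * (mat_adjoint Q * (A * Q))"
    unfolding N using assoc_mult_mat[OF Q' Ac Q] by simp
  also have "\<dots> = (Q * mat_adjoint Q) * (A * Q)"
    using assoc_mult_mat[OF Q Q' mult_carrier_mat[OF Ac Q]] by simp
  also have "\<dots> = A * Q" using Ac Q by (simp add: QQ)
  finally have intertwine: "A * Q = Q * ?N" by simp
  define e where "e i = Q *\<^sub>v unit_vec ?m i" for i
  have e: "e i \<in> carrier_vec ?m" for i using Q by (simp add: e_def)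
  have norm_e: "vec_norm2 (e i) = 1" if "i < ?m" for i
    unfolding e_def using isometry_norm[OF Q QQ(1), of "unit_vec ?m i"] unit_vec_in_unit_vecs[OF that]
    by (simp add: unit_vecs_def)
  have down: "A *\<^sub>v e (Suc i) = (complex_of_real r * ccc_weight k i) \<cdot>\<^sub>v e i" if i: "i < k" for i
  proof -
    have "?N *\<^sub>v unit_vec ?m (Suc i) = (complex_of_real r * ccc_weight k i) \<cdot>\<^sub>v unit_vec ?m i"
    proof (rule eq_vecI)
      fix a assume "a < dim_vec ((complex_of_real r * ccc_weight k i) \<cdot>\<^sub>v unit_vec ?m i)"
      then have a: "a < ?m" by simp
      have "(?N *\<^sub>v unit_vec ?m (Suc i)) $ a = ?N $$ (a, Suc i)" using D a i k by simp
      also have "\<dots> = complex_of_real r * D $$ (a, Suc i)" using D a i k by simp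
      also have "D $$ (a, Suc i) = (if i = a then ccc_weight k i else 0)"
        using index_diag_ccc_block[OF B, of a k "Suc i", folded D_def] a i k by simp
      finally show "(?N *\<^sub>v unit_vec ?m (Suc i)) $ a
          = ((complex_of_real r * ccc_weight k i) \<cdot>\<^sub>v unit_vec ?m i) $ a"
        using a i k by simp
    qed (use D in simp)
    moreover have "A *\<^sub>v e (Suc i) = Q *\<^sub>v (?N *\<^sub>v unit_vec ?m (Suc i))"
      unfolding e_def
      using assoc_mult_mat_vec[OF Ac Q, of "unit_vec ?m (Suc i)"]
        assoc_mult_mat_vec[OF Q smult_carrier_mat[OF D], of "unit_vec ?m (Suc i)"] intertwine by simp
    ultimately show ?thesis using mult_mat_vec[OF Q, of "unit_vec ?m i"] by (simp add: e_def)
  qed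
  \<comment> \<open>The product of the first \<open>j\<close> weights met on the way down.\<close>
  define g where "g j = (if j = 0 then 1 else if j < k then complex_of_real (sqrt 2) else 2)" for j
  have sqrt2: "complex_of_real (sqrt 2) * complex_of_real (sqrt 2) = 2"
    by (simp flip: of_real_mult)
  have descent: "(A ^\<^sub>m j) *\<^sub>v e k = (complex_of_real r ^ j * g j) \<cdot>\<^sub>v e (k - j)" if "j \<le> k" for j
    using that
  proof (induction j)
    case 0
    then show ?case using e[of k] Ac by (simp add: g_def)
  next
    case (Suc j)
    have j: "k - j = Suc (k - Suc j)" using Suc.prems by simp
    have "(A ^\<^sub>m Suc j) *\<^sub>v e k = (complex_of_real r ^ j * g j) \<cdot>\<^sub>v (A *\<^sub>v e (k - j))"
      using Suc pow_mat_Suc_mult_vec[OF Ac e] mult_mat_vec[OF Ac e] by simp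
    also have "\<dots> = (complex_of_real r ^ j * g j * (complex_of_real r * ccc_weight k (k - Suc j)))
        \<cdot>\<^sub>v e (k - Suc j)"
      unfolding j using down[of "k - Suc j"] Suc.prems by (simp add: smult_smult_assoc)
    also have "complex_of_real r ^ j * g j * (complex_of_real r * ccc_weight k (k - Suc j))
        = complex_of_real r ^ Suc j * (g j * ccc_weight k (k - Suc j))"
      by simp
    also have "g j * ccc_weight k (k - Suc j) = g (Suc j)"
      using Suc.prems sqrt2 by (auto simp: g_def ccc_weight_def)
    finally show ?case .
  qed
  have "vec_norm2 ((A ^\<^sub>m k) *\<^sub>v e k) = r ^ k * 2"
    using descent[of k] k r norm_e[of 0] by (simp add: g_def vec_norm2_smult norm_mult norm_power)
  moreover have "e k \<in> unit_vecs ?m" using e norm_e[of k] k by (simp add: unit_vecs_def)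
  ultimately show ?thesis
    using mat_norm2_attained(2)[OF pow_carrier_mat[OF Ac], of "e k" k] by simp
qed

theorem theorem14:
  fixes A :: "complex mat" and n k :: nat
  assumes "A \<in> carrier_mat (n + 1) (n + 1)"
    and "A \<noteq> 0\<^sub>m (n + 1) (n + 1)"
    and "1 \<le> k" and "k \<le> n"
  shows "mat_norm2 (A ^\<^sub>m k) = 2 * (SUP \<zeta>\<in>field_of_values A. cmod (\<zeta> ^ k)) \<longleftrightarrow>
    (\<exists>B \<in> carrier_mat (n - k) (n - k).
       (k < n \<longrightarrow> numerical_radius B \<le> 1 \<and> mat_norm2 (B ^\<^sub>m k) \<le> 2) \<and>
       unitarily_similar A
         (complex_of_real (numerical_radius A) \<cdot>\<^sub>m diag_block_mat [ccc_mat k, B]))"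
    (is "?lhs \<longleftrightarrow> ?rhs")
proof -
  have r: "0 < numerical_radius A" by (rule numerical_radius_pos[OF assms(1,2)])
  have sup: "(SUP \<zeta>\<in>field_of_values A. cmod (\<zeta> ^ k)) = numerical_radius A ^ k"
    by (rule Sup_cmod_power_field_of_values[OF assms(1)]) simp
  show ?thesis unfolding sup
  proof
    assume "mat_norm2 (A ^\<^sub>m k) = 2 * numerical_radius A ^ k"
    from norm_eq_imp_ccc_block[OF assms(1) r assms(3,4) this]
    obtain B where B: "B \<in> carrier_mat (n - k) (n - k)" "numerical_contraction (n - k) B"
      and sim: "unitarily_similar A
        (complex_of_real (numerical_radius A) \<cdot>\<^sub>m diag_block_mat [ccc_mat k, B])"
      by blast
    have "k < n \<longrightarrow> numerical_radius B \<le> 1 \<and> mat_norm2 (B ^\<^sub>m k) \<le> 2"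
      using numerical_contraction_norm_bounds[OF B(2) _ assms(3)] by simp
    with B sim show ?rhs by blast
  next
    assume ?rhs
    then have "2 * numerical_radius A ^ k \<le> mat_norm2 (A ^\<^sub>m k)"
      using ccc_block_imp_norm_ge[OF assms(1) r assms(3,4)] by blast
    moreover have "mat_norm2 (A ^\<^sub>m k) \<le> 2 * numerical_radius A ^ k"
    proof -
      obtain z where "z \<in> unit_vecs (n + 1)" "mat_norm2 (A ^\<^sub>m k) = vec_norm2 ((A ^\<^sub>m k) *\<^sub>v z)"
        using mat_norm2_attained(1)[OF pow_carrier_mat[OF assms(1)], of k] by auto
      then show ?thesis
        using norm_pow_le_numerical_radius[OF assms(1) r _ assms(3), of z]
        by (simp add: unit_vecs_def)
    qed
    ultimately show "mat_norm2 (A ^\<^sub>m k) = 2 * numerical_radius A ^ k" by simp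
  qed
qed

end
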